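(* Let $\downarrow^{\mathrm{eq}}$ be an independence relation on $\mathfrak C^{\mathrm{eq}}$ extending $\downarrow$, and let $M_P=\langle M,P(M)\rangle$ be a small model of $T^2$ with $P(M)$ closed in $M$. If $M_P$ satisfies the Density Property (for $\mathcal L$-1-types), then it satisfies the Density Property for imaginary tuples: that is, if $\bar c$ and $\bar a$ are very small tuples in $M^{\mathrm{eq}}$ and $\bar c\downarrow^{\mathrm{eq}}_{P(\bar a)}\bar a$, then there exists a tuple $\bar c'$ in $M^{\mathrm{eq}}$ with all entries in $\mathrm{cl}^{\mathrm{eq}}(P(M))$ such that $\bar c'\equiv^1_{\bar a}\bar c$.
   Context: $T$ is a complete first-order theory in a language $\mathcal L$ and $\mathfrak C$ is a monster model of $T$; "small" means of cardinality smaller than the monstrosity of $\mathfrak C$ (its degree of saturation and strong homogeneity); tuples have small length. Juxtaposition denotes union, and tuples are identified with their sets of entries. An independence relation on $\mathfrak C$ is a ternary relation $A\downarrow_C B$ on small subsets of $\mathfrak C$ such that for all small $A,B,C,D$: (Invariance) $A\downarrow_B C\Rightarrow\sigma(A)\downarrow_{\sigma(B)}\sigma(C)$ for $\sigma\in\mathrm{Aut}(\mathfrak C)$; (Normality) $A\downarrow_C B\Rightarrow AC\downarrow_C B$; (Symmetry) $A\downarrow_B C\Rightarrow C\downarrow_B A$; (Transitivity) if $B\subseteq C\subseteq D$, then $A\downarrow_B D$ iff $A\downarrow_B C$ and $A\downarrow_C D$; (Finite character) $A\downarrow_B C$ iff $A_0\downarrow_B C$ for all finite $A_0\subseteq A$;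 (Extension) there is $A'\equiv_B A$ with $A'\downarrow_B C$; (Local character) there is a small cardinal $\lambda$ depending only on $\downarrow$ such that for all small $A,C$ there is $C_0\subseteq C$ with $|C_0|<\lambda+|A|^+$ and $A\downarrow_{C_0}C$. Independence relations on $\mathfrak C^{\mathrm{eq}}$ are defined in the same way. Fix an independence relation $\downarrow$ on $\mathfrak C$. $\kappa_0$ is the least regular cardinal $\mu$ such that for every finite tuple $\bar a$ and small set $B$ there is $B_0\subseteq B$ with $|B_0|<\mu$ and $\bar a\downarrow_{B_0}B$. $\mathrm{cl}(A)=\{c\in\mathfrak C:c\downarrow_A c\}$ and $\mathrm{cl}^{\mathrm{eq}}(A)=\{c\in\mathfrak C^{\mathrm{eq}}:c\downarrow^{\mathrm{eq}}_A c\}$. $\mathcal L^2=\mathcal L\cup\{P\}$ with $P$ a new unary predicate; $T^2$ is the theory of all expansions of $T$ to $\mathcal L^2$. A superscript 1 on a model-theoretic notion refers to $\mathcal L$; $S^1_1(A)$ is the set of complete $\mathcal L$-types over $A$ in one variable. Models of $T$ are elementary substructures of $\mathfrak C$; a model of $T^2$ is written $M_P=\langle M,P(M)\rangle$. $P(M)$ is closed in $M$ if $\mathrm{cl}(P(M))\cap M=P(M)$. For $A\subseteq M^{\mathrm{eq}}$, $P(A)=\mathrm{cl}^{\mathrm{eq}}(P(M))\cap A$ (for $A\subseteq M$ this is $P(M)\cap A$). For a complete type $q$ over $A\supseteq B$, $q\downarrow_B A$ means $c\downarrow_B A$ for a realization $c$ of $q$ in $\mathfrak C$. Fix a small cardinal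 $\kappa>\max(\kappa_0,|T|)$; a set or tuple is very small if its cardinality is $<\kappa$. Density Property (for $\mathcal L$-1-types): for every very small $A\subset M$ and $q\in S^1_1(A)$ with $q\downarrow_{P(A)}A$, $q$ is realized in $P(M)$. *)

theory Defs
  imports Main
begin

unbundle cardinal_syntax

section \<open>First-order logic\<close>

text \<open>
  Symbols are taken from sets rather than from whole types, so that a language may, e.g., have no
  function symbols.  Constants are function symbols of arity 0.
\<close>

record ('f, 'r) lang =
  funs :: "'f set"
  rels :: "'r set"
  fun_arity :: "'f \<Rightarrow> nat"
  rel_arity :: "'r \<Rightarrow> nat"

datatype 'f trm = Var nat | Fn 'f "'f trm list"

datatype ('f, 'r) fm =
    Eq "'f trm" "'f trm"
  | Rl 'r "'f trm list"
  | Neg "('f, 'r) fm"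
  | Conj "('f, 'r) fm" "('f, 'r) fm"
  | Ex nat "('f, 'r) fm"

fun is_term :: "('f, 'r, 'z) lang_scheme \<Rightarrow> 'f trm \<Rightarrow> bool" where
  "is_term L (Var x) \<longleftrightarrow> True"
| "is_term L (Fn f ts) \<longleftrightarrow> f \<in> funs L \<and> length ts = fun_arity L f \<and> (\<forall>t\<in>set ts. is_term L t)"

fun is_fm :: "('f, 'r, 'z) lang_scheme \<Rightarrow> ('f, 'r) fm \<Rightarrow> bool" where
  "is_fm L (Eq t u) \<longleftrightarrow> is_term L t \<and> is_term L u"
| "is_fm L (Rl r ts) \<longleftrightarrow> r \<in> rels L \<and> length ts = rel_arity L r \<and> (\<forall>t\<in>set ts. is_term L t)"
| "is_fm L (Neg p) \<longleftrightarrow> is_fm L p"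
| "is_fm L (Conj p q) \<longleftrightarrow> is_fm L p \<and> is_fm L q"
| "is_fm L (Ex x p) \<longleftrightarrow> is_fm L p"

fun fv_trm :: "'f trm \<Rightarrow> nat set" where
  "fv_trm (Var x) = {x}"
| "fv_trm (Fn f ts) = (\<Union>t\<in>set ts. fv_trm t)"

fun fv :: "('f, 'r) fm \<Rightarrow> nat set" where
  "fv (Eq t u) = fv_trm t \<union> fv_trm u"
| "fv (Rl r ts) = (\<Union>t\<in>set ts. fv_trm t)"
| "fv (Neg p) = fv p"
| "fv (Conj p q) = fv p \<union> fv q"
| "fv (Ex x p) = fv p - {x}"

definition formulas :: "('f, 'r, 'z) lang_scheme \<Rightarrow> ('f, 'r) fm set" where
  "formulas L = {p. is_fm L p}"

definition sentences :: "('f, 'r, 'z) lang_scheme \<Rightarrow> ('f, 'r) fm set" where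
  "sentences L = {p \<in> formulas L. fv p = {}}"

record ('f, 'r, 'a) struct =
  univ :: "'a set"
  fun_int :: "'f \<Rightarrow> 'a list \<Rightarrow> 'a"
  rel_int :: "'r \<Rightarrow> 'a list \<Rightarrow> bool"

definition is_struct :: "('f, 'r) lang \<Rightarrow> ('f, 'r, 'a) struct \<Rightarrow> bool" where
  "is_struct L S \<longleftrightarrow> univ S \<noteq> {} \<and>
     (\<forall>f\<in>funs L. \<forall>xs. length xs = fun_arity L f \<and> set xs \<subseteq> univ S \<longrightarrow> fun_int S f xs \<in> univ S)"

fun eval :: "('f, 'r, 'a) struct \<Rightarrow> (nat \<Rightarrow> 'a) \<Rightarrow> 'f trm \<Rightarrow> 'a" where
  "eval S v (Var x) = v x"
| "eval S v (Fn f ts) = fun_int S f (map (eval S v) ts)"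

fun sat :: "('f, 'r, 'a) struct \<Rightarrow> (nat \<Rightarrow> 'a) \<Rightarrow> ('f, 'r) fm \<Rightarrow> bool" where
  "sat S v (Eq t u) \<longleftrightarrow> eval S v t = eval S v u"
| "sat S v (Rl r ts) \<longleftrightarrow> rel_int S r (map (eval S v) ts)"
| "sat S v (Neg p) \<longleftrightarrow> \<not> sat S v p"
| "sat S v (Conj p q) \<longleftrightarrow> sat S v p \<and> sat S v q"
| "sat S v (Ex x p) \<longleftrightarrow> (\<exists>a\<in>univ S. sat S (v(x := a)) p)"

definition models :: "('f, 'r, 'a) struct \<Rightarrow> ('f, 'r) fm set \<Rightarrow> bool" where
  "models S T \<longleftrightarrow> (\<forall>p\<in>T. \<forall>v. range v \<subseteq> univ S \<longrightarrow> sat S v p)"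

text \<open>
  Complete theories are taken to be deductively closed, so that the cardinality of \<open>T\<close> is that of
  the language plus \<open>\<aleph>\<^sub>0\<close>.  Consistency is not part of the definition; it will come from a model.
\<close>

definition complete_theory :: "('f, 'r) lang \<Rightarrow> ('f, 'r) fm set \<Rightarrow> bool" where
  "complete_theory L T \<longleftrightarrow> T \<subseteq> sentences L \<and> (\<forall>p\<in>sentences L. p \<in> T \<or> Neg p \<in> T)"

definition elem_substruct :: "('f, 'r) lang \<Rightarrow> ('f, 'r, 'a) struct \<Rightarrow> 'a set \<Rightarrow> bool" where
  "elem_substruct L S M \<longleftrightarrow>
     M \<subseteq> univ S \<and> is_struct L (S\<lparr>univ := M\<rparr>) \<and>
     (\<forall>p\<in>formulas L. \<forall>v. range v \<subseteq> M \<longrightarrow> (sat (S\<lparr>univ := M\<rparr>) v p \<longleftrightarrow> sat S v p))"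

definition automorphisms :: "('f, 'r) lang \<Rightarrow> ('f, 'r, 'a) struct \<Rightarrow> ('a \<Rightarrow> 'a) set" where
  "automorphisms L S = {\<sigma>. bij_betw \<sigma> (univ S) (univ S) \<and>
     (\<forall>f\<in>funs L. \<forall>xs. length xs = fun_arity L f \<and> set xs \<subseteq> univ S \<longrightarrow>
        \<sigma> (fun_int S f xs) = fun_int S f (map \<sigma> xs)) \<and>
     (\<forall>r\<in>rels L. \<forall>xs. length xs = rel_arity L r \<and> set xs \<subseteq> univ S \<longrightarrow>
        (rel_int S r (map \<sigma> xs) \<longleftrightarrow> rel_int S r xs))}"


section \<open>Types\<close>

text \<open>The language \<open>L(A)\<close> with a constant \<open>Inr a\<close> for each \<open>a \<in> A\<close>, naming \<open>a\<close>.\<close>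

definition param_lang :: "('f, 'r) lang \<Rightarrow> 'a set \<Rightarrow> ('f + 'a, 'r) lang" where
  "param_lang L A =
     \<lparr>funs = funs L <+> A, rels = rels L,
      fun_arity = case_sum (fun_arity L) (\<lambda>_. 0), rel_arity = rel_arity L\<rparr>"

definition param_struct :: "('f, 'r, 'a) struct \<Rightarrow> ('f + 'a, 'r, 'a) struct" where
  "param_struct S =
     \<lparr>univ = univ S, fun_int = case_sum (fun_int S) (\<lambda>a _. a), rel_int = rel_int S\<rparr>"

text \<open>
  Tuples of arbitrary length are families \<open>c\<close> on an index set \<open>I\<close>.  Since formulas have only
  countably many variables, the type of \<open>c\<close> over \<open>A\<close> is probed through all ways \<open>s\<close> of substituting
  entries of \<open>c\<close> for the variables of an \<open>L(A)\<close>-formula.  (For empty \<open>I\<close> there is nothing to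
  compare: both sides are the empty tuple of the same structure.)
\<close>

definition same_type ::
  "('f, 'r) lang \<Rightarrow> ('f, 'r, 'a) struct \<Rightarrow> 'a set \<Rightarrow> 'i set \<Rightarrow> ('i \<Rightarrow> 'a) \<Rightarrow> ('i \<Rightarrow> 'a) \<Rightarrow> bool" where
  "same_type L S A I c c' \<longleftrightarrow>
     (\<forall>p\<in>formulas (param_lang L A). \<forall>s. range s \<subseteq> I \<longrightarrow>
        (sat (param_struct S) (c \<circ> s) p \<longleftrightarrow> sat (param_struct S) (c' \<circ> s) p))"

definition one_formulas :: "('f, 'r) lang \<Rightarrow> 'a set \<Rightarrow> ('f + 'a, 'r) fm set" where
  "one_formulas L A = {p \<in> formulas (param_lang L A). fv p \<subseteq> {0}}"

definition realizes :: "('f, 'r, 'a) struct \<Rightarrow> 'a \<Rightarrow> ('f + 'a, 'r) fm set \<Rightarrow> bool" where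
  "realizes S c q \<longleftrightarrow> (\<forall>p\<in>q. sat (param_struct S) (\<lambda>_. c) p)"

definition one_types ::
  "('f, 'r) lang \<Rightarrow> ('f, 'r, 'a) struct \<Rightarrow> 'a set \<Rightarrow> ('f + 'a, 'r) fm set set" where
  "one_types L S A = {q. q \<subseteq> one_formulas L A \<and>
     (\<forall>p\<in>one_formulas L A. p \<in> q \<or> Neg p \<in> q) \<and>
     (\<forall>F. finite F \<and> F \<subseteq> q \<longrightarrow> (\<exists>c\<in>univ S. realizes S c F))}"


section \<open>Monster models\<close>

text \<open>
  Cardinals are cardinal orders as in the library.  All cardinals occurring below are at most the
  monstrosity \<open>mon\<close>, so up to isomorphism they live on the same type \<open>'k\<close> as \<open>mon\<close>.
\<close>

definition small_in :: "('f, 'r, 'a) struct \<Rightarrow> 'k rel \<Rightarrow> 'a set \<Rightarrow> bool" where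
  "small_in S mon A \<longleftrightarrow> A \<subseteq> univ S \<and> |A| <o mon"

definition saturated :: "('f, 'r) lang \<Rightarrow> ('f, 'r, 'a) struct \<Rightarrow> 'k rel \<Rightarrow> bool" where
  "saturated L S mon \<longleftrightarrow>
     (\<forall>A. small_in S mon A \<longrightarrow> (\<forall>q\<in>one_types L S A. \<exists>c\<in>univ S. realizes S c q))"

text \<open>
  A map \<open>f\<close> on \<open>A\<close> is partial elementary iff \<open>A\<close> and \<open>f ` A\<close>, enumerated by \<open>A\<close>, have the same type
  over the empty set.
\<close>

definition strongly_homogeneous :: "('f, 'r) lang \<Rightarrow> ('f, 'r, 'a) struct \<Rightarrow> 'k rel \<Rightarrow> bool" where
  "strongly_homogeneous L S mon \<longleftrightarrow>
     (\<forall>A f. small_in S mon A \<and> f ` A \<subseteq> univ S \<and> same_type L S {} A (\<lambda>a. a) f \<longrightarrow>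
        (\<exists>\<sigma>\<in>automorphisms L S. \<forall>a\<in>A. \<sigma> a = f a))"

definition monster_model ::
  "('f, 'r) lang \<Rightarrow> ('f, 'r) fm set \<Rightarrow> ('f, 'r, 'a) struct \<Rightarrow> 'k rel \<Rightarrow> bool" where
  "monster_model L T S mon \<longleftrightarrow> is_struct L S \<and> models S T \<and>
     Card_order mon \<and> infinite (Field mon) \<and> saturated L S mon \<and> strongly_homogeneous L S mon"


section \<open>Imaginaries\<close>

text \<open>
  An \<open>n\<close>-ary equivalence formula \<open>E(x, y)\<close> has the variables \<open>0, \<dots>, n - 1\<close> for \<open>x\<close> and
  \<open>n, \<dots>, 2n - 1\<close> for \<open>y\<close>.
\<close>

definition tuples :: "'a set \<Rightarrow> nat \<Rightarrow> 'a list set" where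
  "tuples A n = {xs. length xs = n \<and> set xs \<subseteq> A}"

definition defined_rel ::
  "('f, 'r, 'a) struct \<Rightarrow> nat \<Rightarrow> ('f, 'r) fm \<Rightarrow> ('a list \<times> 'a list) set" where
  "defined_rel S n E =
     {(xs, ys). xs \<in> tuples (univ S) n \<and> ys \<in> tuples (univ S) n \<and> sat S ((!) (xs @ ys)) E}"

definition equiv_fm :: "('f, 'r) lang \<Rightarrow> ('f, 'r, 'a) struct \<Rightarrow> nat \<Rightarrow> ('f, 'r) fm \<Rightarrow> bool" where
  "equiv_fm L S n E \<longleftrightarrow> 0 < n \<and> E \<in> formulas L \<and> fv E \<subseteq> {..<2 * n} \<and>
     equiv (tuples (univ S) n) (defined_rel S n E)"

text \<open>
  The sorts of the imaginary structure are the home sort (elements \<open>Elem a\<close>) and one sort for each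
  pair of \<open>n\<close> and an equivalence formula \<open>E\<close> (elements \<open>Cls n E X\<close> with \<open>X\<close> an \<open>E\<close>-class).
\<close>

datatype ('f, 'r, 'a) imag = Elem 'a | Cls nat "('f, 'r) fm" "'a list set"

definition class_of ::
  "('f, 'r, 'a) struct \<Rightarrow> nat \<Rightarrow> ('f, 'r) fm \<Rightarrow> 'a list \<Rightarrow> ('f, 'r, 'a) imag" where
  "class_of S n E xs = Cls n E (defined_rel S n E `` {xs})"

text \<open>
  For an elementary substructure \<open>M\<close> of \<open>S\<close> this is \<open>M\<^sup>e\<^sup>q\<close>, viewed inside \<open>S\<^sup>e\<^sup>q\<close>: the imaginaries
  with a representative in \<open>M\<close>.
\<close>

definition imaginaries ::
  "('f, 'r) lang \<Rightarrow> ('f, 'r, 'a) struct \<Rightarrow> 'a set \<Rightarrow> ('f, 'r, 'a) imag set" where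
  "imaginaries L S M =
     Elem ` M \<union> {class_of S n E xs | n E xs. equiv_fm L S n E \<and> xs \<in> tuples M n}"

text \<open>
  We use the one-sorted presentation of \<open>S\<^sup>e\<^sup>q\<close>: sorts are unary predicates, and operations that
  make sense only on some sorts (the functions of \<open>L\<close> and the projections onto the
  quotients) are given by their graphs.  A graph takes the value of the operation as last argument.
\<close>

datatype ('f, 'r) eq_sym =
    Home_Sort
  | Quot_Sort nat "('f, 'r) fm"
  | Base_Rel 'r
  | Base_Fun 'f
  | Proj nat "('f, 'r) fm"

definition eq_lang ::
  "('f, 'r) lang \<Rightarrow> ('f, 'r, 'a) struct \<Rightarrow> ('f, ('f, 'r) eq_sym) lang" where
  "eq_lang L S =
     \<lparr>funs = {},
      rels = {Home_Sort} \<union> {Quot_Sort n E | n E. equiv_fm L S n E} \<union> Base_Rel ` rels L \<union>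
        Base_Fun ` funs L \<union> {Proj n E | n E. equiv_fm L S n E},
      fun_arity = (\<lambda>_. 0),
      rel_arity = (\<lambda>R. case R of
          Home_Sort \<Rightarrow> 1
        | Quot_Sort n E \<Rightarrow> 1
        | Base_Rel r \<Rightarrow> rel_arity L r
        | Base_Fun f \<Rightarrow> Suc (fun_arity L f)
        | Proj n E \<Rightarrow> Suc n)\<rparr>"

definition eq_struct ::
  "('f, 'r) lang \<Rightarrow> ('f, 'r, 'a) struct \<Rightarrow> ('f, ('f, 'r) eq_sym, ('f, 'r, 'a) imag) struct" where
  "eq_struct L S =
     \<lparr>univ = imaginaries L S (univ S),
      fun_int = (\<lambda>_ _. undefined),
      rel_int = (\<lambda>R us. case R of
          Home_Sort \<Rightarrow> (\<exists>a\<in>univ S. us = [Elem a])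
        | Quot_Sort n E \<Rightarrow> (\<exists>xs\<in>tuples (univ S) n. us = [class_of S n E xs])
        | Base_Rel r \<Rightarrow>
            (\<exists>xs\<in>tuples (univ S) (rel_arity L r). us = map Elem xs \<and> rel_int S r xs)
        | Base_Fun f \<Rightarrow>
            (\<exists>xs\<in>tuples (univ S) (fun_arity L f). us = map Elem xs @ [Elem (fun_int S f xs)])
        | Proj n E \<Rightarrow>
            (\<exists>xs\<in>tuples (univ S) n. us = map Elem xs @ [class_of S n E xs]))\<rparr>"


section \<open>Independence relations\<close>

text \<open>
  \<open>ind A C B\<close> says that \<open>A\<close> is independent from \<open>B\<close> over \<open>C\<close>.  Only its values on small subsets of
  the structure are relevant.
\<close>

locale independence_relation =
  fixes L :: "('f, 'r) lang"
    and S :: "('f, 'r, 'a) struct"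
    and mon :: "'k rel"
    and ind :: "'a set \<Rightarrow> 'a set \<Rightarrow> 'a set \<Rightarrow> bool"
  assumes invariance:
      "\<lbrakk>small_in S mon A; small_in S mon B; small_in S mon C; \<sigma> \<in> automorphisms L S; ind A B C\<rbrakk>
       \<Longrightarrow> ind (\<sigma> ` A) (\<sigma> ` B) (\<sigma> ` C)"
    and normality:
      "\<lbrakk>small_in S mon A; small_in S mon B; small_in S mon C; ind A C B\<rbrakk> \<Longrightarrow> ind (A \<union> C) C B"
    and symmetry:
      "\<lbrakk>small_in S mon A; small_in S mon B; small_in S mon C; ind A B C\<rbrakk> \<Longrightarrow> ind C B A"
    and transitivity:
      "\<lbrakk>small_in S mon A; small_in S mon D; B \<subseteq> C; C \<subseteq> D\<rbrakk>
       \<Longrightarrow> ind A B D \<longleftrightarrow> ind A B C \<and> ind A C D"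
    and finite_character:
      "\<lbrakk>small_in S mon A; small_in S mon B; small_in S mon C\<rbrakk>
       \<Longrightarrow> ind A B C \<longleftrightarrow> (\<forall>A0. finite A0 \<and> A0 \<subseteq> A \<longrightarrow> ind A0 B C)"
    and extension:
      "\<lbrakk>small_in S mon A; small_in S mon B; small_in S mon C\<rbrakk>
       \<Longrightarrow> \<exists>g. g ` A \<subseteq> univ S \<and> same_type L S B A (\<lambda>a. a) g \<and> ind (g ` A) B C"
    and local_character:
      "\<exists>l :: 'k rel. Card_order l \<and> l <o mon \<and>
         (\<forall>A C. small_in S mon A \<and> small_in S mon C \<longrightarrow>
            (\<exists>C0\<subseteq>C. |C0| <o l +c cardSuc |A| \<and> ind A C0 C))"

text \<open>The operator \<open>cl\<close>; with an independence relation on \<open>S\<^sup>e\<^sup>q\<close> it is \<open>cl\<^sup>e\<^sup>q\<close>.\<close>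

definition cl ::
  "('f, 'r, 'a) struct \<Rightarrow> ('a set \<Rightarrow> 'a set \<Rightarrow> 'a set \<Rightarrow> bool) \<Rightarrow> 'a set \<Rightarrow> 'a set" where
  "cl S ind A = {c \<in> univ S. ind {c} A {c}}"

definition local_bound ::
  "('f, 'r, 'a) struct \<Rightarrow> 'k rel \<Rightarrow> ('a set \<Rightarrow> 'a set \<Rightarrow> 'a set \<Rightarrow> bool) \<Rightarrow> 'k rel \<Rightarrow> bool" where
  "local_bound S mon ind \<mu> \<longleftrightarrow>
     Card_order \<mu> \<and> infinite (Field \<mu>) \<and> regularCard \<mu> \<and>
     (\<forall>A B. finite A \<and> A \<subseteq> univ S \<and> small_in S mon B \<longrightarrow>
        (\<exists>B0\<subseteq>B. |B0| <o \<mu> \<and> ind A B0 B))"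

definition is_kappa0 ::
  "('f, 'r, 'a) struct \<Rightarrow> 'k rel \<Rightarrow> ('a set \<Rightarrow> 'a set \<Rightarrow> 'a set \<Rightarrow> bool) \<Rightarrow> 'k rel \<Rightarrow> bool" where
  "is_kappa0 S mon ind \<kappa>0 \<longleftrightarrow>
     local_bound S mon ind \<kappa>0 \<and> (\<forall>\<mu>. local_bound S mon ind \<mu> \<longrightarrow> \<kappa>0 \<le>o \<mu>)"

definition extends_to_eq ::
  "('f, 'r, 'a) struct \<Rightarrow> 'k rel \<Rightarrow> ('a set \<Rightarrow> 'a set \<Rightarrow> 'a set \<Rightarrow> bool) \<Rightarrow>
   (('f, 'r, 'a) imag set \<Rightarrow> ('f, 'r, 'a) imag set \<Rightarrow> ('f, 'r, 'a) imag set \<Rightarrow> bool) \<Rightarrow> bool" where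
  "extends_to_eq S mon ind ind_eq \<longleftrightarrow>
     (\<forall>A B C. small_in S mon A \<and> small_in S mon B \<and> small_in S mon C \<longrightarrow>
        (ind_eq (Elem ` A) (Elem ` B) (Elem ` C) \<longleftrightarrow> ind A B C))"


section \<open>Pairs\<close>

text \<open>
  The theory \<open>T\<^sup>2\<close> imposes nothing on the new predicate, so a model of it is a model of \<open>T\<close>, i.e. an
  elementary substructure \<open>M\<close> of the monster \<open>S\<close>, with an arbitrary subset \<open>P\<close> as interpretation
  of the predicate.
\<close>

definition pair_model :: "('f, 'r) lang \<Rightarrow> ('f, 'r, 'a) struct \<Rightarrow> 'a set \<Rightarrow> 'a set \<Rightarrow> bool" where
  "pair_model L S M P \<longleftrightarrow> elem_substruct L S M \<and> P \<subseteq> M"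

definition closed_in ::
  "('f, 'r, 'a) struct \<Rightarrow> ('a set \<Rightarrow> 'a set \<Rightarrow> 'a set \<Rightarrow> bool) \<Rightarrow> 'a set \<Rightarrow> 'a set \<Rightarrow> bool" where
  "closed_in S ind M P \<longleftrightarrow> cl S ind P \<inter> M = P"

definition type_indep ::
  "('f, 'r, 'a) struct \<Rightarrow> ('a set \<Rightarrow> 'a set \<Rightarrow> 'a set \<Rightarrow> bool) \<Rightarrow>
   ('f + 'a, 'r) fm set \<Rightarrow> 'a set \<Rightarrow> 'a set \<Rightarrow> bool" where
  "type_indep S ind q B A \<longleftrightarrow> (\<exists>c\<in>univ S. realizes S c q \<and> ind {c} B A)"

definition density_property ::
  "('f, 'r) lang \<Rightarrow> ('f, 'r, 'a) struct \<Rightarrow> ('a set \<Rightarrow> 'a set \<Rightarrow> 'a set \<Rightarrow> bool) \<Rightarrow>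
   'k rel \<Rightarrow> 'a set \<Rightarrow> 'a set \<Rightarrow> bool" where
  "density_property L S ind \<kappa> M P \<longleftrightarrow>
     (\<forall>A q. A \<subseteq> M \<and> |A| <o \<kappa> \<and> q \<in> one_types L S A \<and> type_indep S ind q (P \<inter> A) A \<longrightarrow>
        (\<exists>c\<in>P. realizes S c q))"

text \<open>\<open>P(A)\<close> for a set \<open>A\<close> of imaginaries.\<close>

definition P_eq ::
  "('f, 'r) lang \<Rightarrow> ('f, 'r, 'a) struct \<Rightarrow>
   (('f, 'r, 'a) imag set \<Rightarrow> ('f, 'r, 'a) imag set \<Rightarrow> ('f, 'r, 'a) imag set \<Rightarrow> bool) \<Rightarrow>
   'a set \<Rightarrow> ('f, 'r, 'a) imag set \<Rightarrow> ('f, 'r, 'a) imag set" where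
  "P_eq L S ind_eq P A = cl (eq_struct L S) ind_eq (Elem ` P) \<inter> A"

end

theory Submission
  imports Defs
begin

text \<open>
  The proof reduces imaginary tuples to real ones, and real tuples to single elements.

  Let \<open>U\<close> be the set of entries of \<open>a\<close> and \<open>Q = P(U)\<close>.  Extension, applied to representatives of
  \<open>c\<close> over \<open>c Q\<close>, yields a real set \<open>D\<close> of representatives of \<open>c\<close> that is independent from \<open>U\<close> over
  \<open>Q\<close> (\<open>independent_representatives\<close>).  Choose a very small real set \<open>A\<close> in \<open>M\<close> that contains
  representatives of \<open>a\<close> and so many elements of \<open>P(M)\<close> that \<open>Q\<close> lies in the closure of \<open>P(A)\<close>
  (\<open>small_closure_base\<close>).  A second use of extension gives an automorphism \<open>\<sigma>\<close> that fixes \<open>U\<close> and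
  makes \<open>\<sigma>(D)\<close> independent from \<open>A\<close> over \<open>Q\<close> (\<open>independent_conjugate\<close>), hence over \<open>P(A)\<close>
  (\<open>ind_change_base\<close>).  This is a statement about real sets only, and the density property, applied to
  the elements of \<open>\<sigma>(D)\<close> one by one, gives an automorphism \<open>\<tau>\<close> fixing \<open>A\<close>, and therefore \<open>U\<close>, with
  \<open>\<tau>(\<sigma>(D)) \<subseteq> P(M)\<close> (\<open>density_real_tuple\<close>).  Then \<open>c' = \<tau>(\<sigma>(c))\<close> has the type of \<open>c\<close> over
  \<open>a\<close>, and its representatives lie in \<open>P(M)\<close>, so that \<open>c'\<close> lies in the closure of \<open>P(M)\<close>.

  All automorphisms of the imaginary structure that occur are induced by automorphisms of the monster
  model.  To obtain them from extension in the imaginary structure one needs that an elementary map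
  there, restricted to real elements, is elementary in the monster model (\<open>same_type_real\<close>); this
  is a translation of formulas into the relational language of the imaginary structure.
\<close>

section \<open>Satisfaction, automorphisms and substitution\<close>

lemma finite_fv_trm: "finite (fv_trm t)"
  by (induction t) auto

lemma finite_fv: "finite (fv p)"
  by (induction p) (auto simp: finite_fv_trm)

lemma eval_cong: "(\<And>x. x \<in> fv_trm t \<Longrightarrow> v x = w x) \<Longrightarrow> eval S v t = eval S w t"
proof (induction t)
  case (Fn f ts)
  then have "map (eval S v) ts = map (eval S w) ts"
    by (auto intro!: map_cong)
  then show ?case by (simp only: eval.simps)
qed simp

lemma sat_cong: "(\<And>x. x \<in> fv p \<Longrightarrow> v x = w x) \<Longrightarrow> sat S v p \<longleftrightarrow> sat S w p"
proof (induction p arbitrary: v w)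
  case (Eq t u)
  have "eval S v t = eval S w t" "eval S v u = eval S w u"
    by (rule eval_cong, simp add: Eq)+
  then show ?case by simp
next
  case (Rl r ts)
  have "map (eval S v) ts = map (eval S w) ts"
    by (rule map_cong[OF refl], rule eval_cong, rule Rl) auto
  then show ?case by (simp only: sat.simps)
next
  case (Neg p)
  have "sat S v p \<longleftrightarrow> sat S w p" by (rule Neg.IH, rule Neg.prems) simp
  then show ?case by simp
next
  case (Conj p q)
  have "sat S v p \<longleftrightarrow> sat S w p" by (rule Conj.IH, rule Conj.prems) simp
  moreover have "sat S v q \<longleftrightarrow> sat S w q" by (rule Conj.IH, rule Conj.prems) simp
  ultimately show ?case by simp
next
  case (Ex x p)
  have "sat S (v(x := b)) p \<longleftrightarrow> sat S (w(x := b)) p" for b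
    by (rule Ex.IH) (use Ex.prems in simp)
  then show ?case by simp
qed

lemma is_struct_fun:
  "\<lbrakk>is_struct L S; f \<in> funs L; length xs = fun_arity L f; set xs \<subseteq> univ S\<rbrakk>
    \<Longrightarrow> fun_int S f xs \<in> univ S"
  by (simp add: is_struct_def)

lemma automorphism_fun:
  "\<lbrakk>\<sigma> \<in> automorphisms L S; f \<in> funs L; length xs = fun_arity L f; set xs \<subseteq> univ S\<rbrakk>
    \<Longrightarrow> fun_int S f (map \<sigma> xs) = \<sigma> (fun_int S f xs)"
  by (simp add: automorphisms_def)

lemma automorphism_rel:
  "\<lbrakk>\<sigma> \<in> automorphisms L S; r \<in> rels L; length xs = rel_arity L r; set xs \<subseteq> univ S\<rbrakk>
    \<Longrightarrow> rel_int S r (map \<sigma> xs) \<longleftrightarrow> rel_int S r xs"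
  by (simp add: automorphisms_def)

lemma automorphism_univ: "\<sigma> \<in> automorphisms L S \<Longrightarrow> x \<in> univ S \<Longrightarrow> \<sigma> x \<in> univ S"
  by (auto simp: automorphisms_def bij_betw_def)

lemma eval_automorphism:
  assumes "is_struct L S" and "\<sigma> \<in> automorphisms L S"
  shows "is_term L t \<Longrightarrow> (\<And>x. x \<in> fv_trm t \<Longrightarrow> v x \<in> univ S \<and> w x = \<sigma> (v x)) \<Longrightarrow>
    eval S v t \<in> univ S \<and> eval S w t = \<sigma> (eval S v t)"
proof (induction t)
  case (Fn f ts)
  have ih: "eval S v t \<in> univ S \<and> eval S w t = \<sigma> (eval S v t)" if "t \<in> set ts" for t
  proof (rule Fn.IH[OF that])
    show "is_term L t" using Fn.prems(1) that by simp
    show "v x \<in> univ S \<and> w x = \<sigma> (v x)" if "x \<in> fv_trm t" for x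
      using that \<open>t \<in> set ts\<close> by (intro Fn.prems(2)) auto
  qed
  then have eq: "map (eval S w) ts = map \<sigma> (map (eval S v) ts)"
    by simp
  have f: "f \<in> funs L" "length (map (eval S v) ts) = fun_arity L f"
    using Fn.prems(1) by simp_all
  have ts: "set (map (eval S v) ts) \<subseteq> univ S"
    using ih by auto
  show ?case
    using is_struct_fun[OF assms(1) f ts] automorphism_fun[OF assms(2) f ts]
    by (simp only: eval.simps eq)
qed simp

lemma sat_automorphism:
  assumes S: "is_struct L S" and \<sigma>: "\<sigma> \<in> automorphisms L S"
  shows "is_fm L p \<Longrightarrow> (\<And>x. x \<in> fv p \<Longrightarrow> v x \<in> univ S \<and> w x = \<sigma> (v x)) \<Longrightarrow>
    sat S w p \<longleftrightarrow> sat S v p"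
proof (induction p arbitrary: v w)
  case (Eq t u)
  have "eval S v t \<in> univ S \<and> eval S w t = \<sigma> (eval S v t)"
    using Eq.prems by (intro eval_automorphism[OF S \<sigma>]) simp_all
  moreover have "eval S v u \<in> univ S \<and> eval S w u = \<sigma> (eval S v u)"
    using Eq.prems by (intro eval_automorphism[OF S \<sigma>]) simp_all
  moreover have "inj_on \<sigma> (univ S)"
    using \<sigma> by (auto simp: automorphisms_def bij_betw_def)
  ultimately show ?case by (simp add: inj_on_eq_iff)
next
  case (Rl r ts)
  have ev: "eval S v t \<in> univ S \<and> eval S w t = \<sigma> (eval S v t)" if "t \<in> set ts" for t
  proof (rule eval_automorphism[OF S \<sigma>])
    show "is_term L t" using Rl.prems(1) that by simp
    show "v x \<in> univ S \<and> w x = \<sigma> (v x)" if "x \<in> fv_trm t" for x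
      using that \<open>t \<in> set ts\<close> by (intro Rl.prems(2)) auto
  qed
  then have eq: "map (eval S w) ts = map \<sigma> (map (eval S v) ts)" by simp
  have "r \<in> rels L" "length (map (eval S v) ts) = rel_arity L r"
    using Rl.prems(1) by simp_all
  moreover have "set (map (eval S v) ts) \<subseteq> univ S"
    using ev by auto
  ultimately have "rel_int S r (map \<sigma> (map (eval S v) ts)) \<longleftrightarrow> rel_int S r (map (eval S v) ts)"
    by (rule automorphism_rel[OF \<sigma>])
  then show ?case by (simp only: sat.simps eq)
next
  case (Neg p)
  have "sat S w p \<longleftrightarrow> sat S v p"
    by (rule Neg.IH) (use Neg.prems in simp_all)
  then show ?case by simp
next
  case (Conj p q)
  have "sat S w p \<longleftrightarrow> sat S v p"
    by (rule Conj.IH) (use Conj.prems in simp_all)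
  moreover have "sat S w q \<longleftrightarrow> sat S v q"
    by (rule Conj.IH) (use Conj.prems in simp_all)
  ultimately show ?case by simp
next
  case (Ex x p)
  have step: "sat S (w(x := \<sigma> b)) p \<longleftrightarrow> sat S (v(x := b)) p" if "b \<in> univ S" for b
    by (rule Ex.IH) (use Ex.prems that in simp_all)
  have onto: "\<sigma> ` univ S = univ S"
    using \<sigma> by (auto simp: automorphisms_def bij_betw_def)
  have "(\<exists>b\<in>univ S. sat S (w(x := b)) p) \<longleftrightarrow> (\<exists>b\<in>\<sigma> ` univ S. sat S (w(x := b)) p)"
    unfolding onto ..
  also have "\<dots> \<longleftrightarrow> (\<exists>b\<in>univ S. sat S (v(x := b)) p)"
    using step by (simp only: bex_simps) blast
  finally show ?case by simp
qed

lemma param_struct_is_struct: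
  "is_struct L S \<Longrightarrow> A \<subseteq> univ S \<Longrightarrow> is_struct (param_lang L A) (param_struct S)"
  by (auto simp: is_struct_def param_lang_def param_struct_def split: sum.splits)

lemma param_automorphism:
  "\<sigma> \<in> automorphisms L S \<Longrightarrow> (\<And>a. a \<in> A \<Longrightarrow> \<sigma> a = a) \<Longrightarrow>
    \<sigma> \<in> automorphisms (param_lang L A) (param_struct S)"
  by (auto simp: automorphisms_def param_lang_def param_struct_def)

lemma param_univ [simp]: "univ (param_struct S) = univ S"
  by (simp add: param_struct_def)

lemma same_type_automorphism:
  assumes "is_struct L S" "\<sigma> \<in> automorphisms L S" "A \<subseteq> univ S" "\<And>a. a \<in> A \<Longrightarrow> \<sigma> a = a"
    and c: "c ` I \<subseteq> univ S"
  shows "same_type L S A I c (\<sigma> \<circ> c)"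
  unfolding same_type_def
proof (intro ballI allI impI)
  fix p and s :: "nat \<Rightarrow> _"
  assume "p \<in> formulas (param_lang L A)" and s: "range s \<subseteq> I"
  have "c (s n) \<in> univ S" for n using s c by blast
  then show "sat (param_struct S) (c \<circ> s) p \<longleftrightarrow> sat (param_struct S) (\<sigma> \<circ> c \<circ> s) p"
    using sat_automorphism[OF param_struct_is_struct[OF assms(1,3)] param_automorphism[OF assms(2,4)],
        of p "c \<circ> s" "\<sigma> \<circ> c \<circ> s"] \<open>p \<in> _\<close>
    by (simp add: formulas_def)
qed

text \<open>
  Substitution of terms for variables.  Bound variables are shifted by one, so that terms whose only
  variable is \<open>0\<close> can be substituted without capture.
\<close>

fun subst_trm :: "(nat \<Rightarrow> 'f trm) \<Rightarrow> 'f trm \<Rightarrow> 'f trm" where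
  "subst_trm \<tau> (Var x) = \<tau> x"
| "subst_trm \<tau> (Fn f ts) = Fn f (map (subst_trm \<tau>) ts)"

fun subst :: "(nat \<Rightarrow> 'f trm) \<Rightarrow> ('f, 'r) fm \<Rightarrow> ('f, 'r) fm" where
  "subst \<tau> (Eq t u) = Eq (subst_trm \<tau> t) (subst_trm \<tau> u)"
| "subst \<tau> (Rl r ts) = Rl r (map (subst_trm \<tau>) ts)"
| "subst \<tau> (Neg p) = Neg (subst \<tau> p)"
| "subst \<tau> (Conj p q) = Conj (subst \<tau> p) (subst \<tau> q)"
| "subst \<tau> (Ex x p) = Ex (Suc x) (subst (\<tau>(x := Var (Suc x))) p)"

lemma eval_subst_trm: "eval S v (subst_trm \<tau> t) = eval S (\<lambda>x. eval S v (\<tau> x)) t"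
proof (induction t)
  case (Fn f ts)
  then have "map (eval S v \<circ> subst_trm \<tau>) ts = map (eval S (\<lambda>x. eval S v (\<tau> x))) ts"
    by simp
  then show ?case by (metis eval.simps(2) map_map subst_trm.simps(2))
qed simp

lemma sat_subst:
  "(\<And>x. fv_trm (\<tau> x) \<subseteq> {0, Suc x}) \<Longrightarrow>
    sat S v (subst \<tau> p) \<longleftrightarrow> sat S (\<lambda>x. eval S v (\<tau> x)) p"
proof (induction p arbitrary: v \<tau>)
  case (Rl r ts)
  have "map (eval S v) (map (subst_trm \<tau>) ts) = map (eval S (\<lambda>x. eval S v (\<tau> x))) ts"
    by (simp add: eval_subst_trm)
  then show ?case by (metis sat.simps(2) subst.simps(2))
next
  case (Ex x p)
  let ?\<tau> = "\<tau>(x := Var (Suc x))"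
  have "sat S (v(Suc x := b)) (subst ?\<tau> p) \<longleftrightarrow> sat S ((\<lambda>y. eval S v (\<tau> y))(x := b)) p" for b
  proof -
    have "eval S (v(Suc x := b)) (?\<tau> y) = ((\<lambda>y. eval S v (\<tau> y))(x := b)) y" for y
    proof (cases "y = x")
      case False
      have "eval S (v(Suc x := b)) (\<tau> y) = eval S v (\<tau> y)"
        using Ex.prems[of y] False by (intro eval_cong) auto
      then show ?thesis using False by simp
    qed simp
    then have eq: "(\<lambda>y. eval S (v(Suc x := b)) (?\<tau> y)) = (\<lambda>y. eval S v (\<tau> y))(x := b)"
      by (rule ext)
    have "sat S (v(Suc x := b)) (subst ?\<tau> p) \<longleftrightarrow> sat S (\<lambda>y. eval S (v(Suc x := b)) (?\<tau> y)) p"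
      using Ex.prems by (intro Ex.IH) auto
    then show ?thesis unfolding eq .
  qed
  then show ?case by simp
qed (simp_all add: eval_subst_trm)

lemma fv_subst_trm: "fv_trm (subst_trm \<tau> t) = (\<Union>x\<in>fv_trm t. fv_trm (\<tau> x))"
  by (induction t) auto

lemma fv_subst: "fv (subst \<tau> p) \<subseteq> (\<Union>x\<in>fv p. fv_trm (\<tau> x))"
proof (induction p arbitrary: \<tau>)
  case (Conj p q)
  show ?case using Conj[of \<tau>] unfolding subst.simps fv.simps by blast
next
  case (Ex x p)
  show ?case
  proof
    fix y assume "y \<in> fv (subst \<tau> (Ex x p))"
    then obtain z where "z \<in> fv p" "y \<in> fv_trm ((\<tau>(x := Var (Suc x))) z)" "y \<noteq> Suc x"
      using Ex.IH[of "\<tau>(x := Var (Suc x))"] unfolding subst.simps fv.simps by blast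
    then show "y \<in> (\<Union>z\<in>fv (Ex x p). fv_trm (\<tau> z))"
      by (cases "z = x") auto
  qed
qed (simp_all add: fv_subst_trm)

lemma is_term_subst:
  "is_term (param_lang L {}) t \<Longrightarrow> (\<And>x. is_term (param_lang L B) (\<tau> x)) \<Longrightarrow>
    is_term (param_lang L B) (subst_trm \<tau> t)"
  by (induction t) (auto simp: param_lang_def)

lemma is_fm_subst:
  "is_fm (param_lang L {}) p \<Longrightarrow> (\<And>x. is_term (param_lang L B) (\<tau> x)) \<Longrightarrow>
    is_fm (param_lang L B) (subst \<tau> p)"
proof (induction p arbitrary: \<tau>)
  case (Rl r ts)
  then show ?case using is_term_subst[of L _ B \<tau>] by (auto simp: param_lang_def)
qed (auto intro: is_term_subst)


section \<open>Elementary relations\<close>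

text \<open>
  A partial elementary map, given by its graph.  Functionality and injectivity need not be
  required: they follow by considering the formula \<open>x = y\<close>.
\<close>

definition elementary ::
  "('f, 'r) lang \<Rightarrow> ('f, 'r, 'a) struct \<Rightarrow> ('a \<times> 'a) set \<Rightarrow> bool" where
  "elementary L S G \<longleftrightarrow>
     (\<forall>p\<in>formulas (param_lang L {}). \<forall>s s'. (\<forall>n. (s n, s' n) \<in> G) \<longrightarrow>
        (sat (param_struct S) s p \<longleftrightarrow> sat (param_struct S) s' p))"

lemma elementaryD:
  "elementary L S G \<Longrightarrow> is_fm (param_lang L {}) p \<Longrightarrow> (\<And>n. (s n, s' n) \<in> G) \<Longrightarrow>
    sat (param_struct S) s p \<longleftrightarrow> sat (param_struct S) s' p"
  by (auto simp: elementary_def formulas_def)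

lemma elementary_single_valued:
  assumes "elementary L S G" "(x, y) \<in> G" "(x, z) \<in> G"
  shows "y = z"
  using elementaryD[OF assms(1), of "Eq (Var 0) (Var 1)" "\<lambda>_. x" "\<lambda>n. if n = 0 then y else z"]
    assms(2,3) by simp

lemma elementary_converse: "elementary L S G \<Longrightarrow> elementary L S (G\<inverse>)"
  unfolding elementary_def converse_iff by blast

lemma elementary_Id_on: "elementary L S (Id_on A)"
  unfolding elementary_def
proof (intro ballI allI impI)
  fix p and s s' :: "nat \<Rightarrow> _"
  assume "\<forall>n. (s n, s' n) \<in> Id_on A"
  then have "s = s'" by (auto simp: Id_on_def)
  then show "sat (param_struct S) s p \<longleftrightarrow> sat (param_struct S) s' p" by simp
qed

lemma elementary_Union_chain:
  fixes L :: "('f, 'r) lang" and S :: "('f, 'r, 'a) struct"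
  assumes chain: "subset.chain {G. elementary L S G} \<C>"
  shows "elementary L S (\<Union>\<C>)"
  unfolding elementary_def
proof (intro ballI allI impI)
  fix p :: "('f + 'a, 'r) fm" and s s' :: "nat \<Rightarrow> 'a"
  assume p: "p \<in> formulas (param_lang L {})" and ss: "\<forall>n. (s n, s' n) \<in> \<Union>\<C>"
  let ?F = "insert 0 (fv p)"
  have "finite ((\<lambda>n. (s n, s' n)) ` ?F)" by (simp add: finite_fv)
  moreover have "(\<lambda>n. (s n, s' n)) ` ?F \<subseteq> \<Union>\<C>" using ss by auto
  moreover have "\<C> \<noteq> {}" using ss by auto
  ultimately obtain G where G: "G \<in> \<C>" "(\<lambda>n. (s n, s' n)) ` ?F \<subseteq> G"
    using chain by (rule finite_subset_Union_chain)
  let ?r = "\<lambda>n. if n \<in> fv p then n else 0"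
  have "elementary L S G" using G(1) chain by (auto simp: subset.chain_def)
  then have "sat (param_struct S) (\<lambda>n. s (?r n)) p \<longleftrightarrow> sat (param_struct S) (\<lambda>n. s' (?r n)) p"
    by (rule elementaryD) (use G(2) p in \<open>auto simp: formulas_def\<close>)
  then show "sat (param_struct S) s p \<longleftrightarrow> sat (param_struct S) s' p"
    using sat_cong[of p s "\<lambda>n. s (?r n)"] sat_cong[of p s' "\<lambda>n. s' (?r n)"] by simp
qed

lemma elementary_extends_to_automorphism:
  fixes L :: "('f, 'r) lang" and S :: "('f, 'r, 'a) struct"
  assumes hom: "strongly_homogeneous L S mon" and G: "elementary L S G" "G \<subseteq> univ S \<times> univ S"
    and small: "|Domain G| <o mon"
  obtains \<sigma> where "\<sigma> \<in> automorphisms L S" "\<And>x y. (x, y) \<in> G \<Longrightarrow> \<sigma> x = y"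
proof -
  define f where "f x = (SOME y. (x, y) \<in> G)" for x
  have f: "(x, f x) \<in> G" if "x \<in> Domain G" for x
    using that unfolding f_def by (auto intro: someI)
  have "same_type L S {} (Domain G) (\<lambda>a. a) f"
    unfolding same_type_def
  proof (intro ballI allI impI)
    fix p :: "('f + 'a, 'r) fm" and s :: "nat \<Rightarrow> 'a"
    assume p: "p \<in> formulas (param_lang L {})" and s: "range s \<subseteq> Domain G"
    have "(((\<lambda>a. a) \<circ> s) n, (f \<circ> s) n) \<in> G" for n
      using f[of "s n"] s by auto
    then show "sat (param_struct S) ((\<lambda>a. a) \<circ> s) p \<longleftrightarrow> sat (param_struct S) (f \<circ> s) p"
      using p by (intro elementaryD[OF G(1)]) (simp_all add: formulas_def)
  qed
  moreover have "small_in S mon (Domain G)" "f ` Domain G \<subseteq> univ S"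
    using small G(2) f by (auto simp: small_in_def)
  ultimately have "\<exists>\<sigma>\<in>automorphisms L S. \<forall>x\<in>Domain G. \<sigma> x = f x"
    using hom by (simp add: strongly_homogeneous_def)
  then obtain \<sigma> where \<sigma>: "\<sigma> \<in> automorphisms L S" "\<And>x. x \<in> Domain G \<Longrightarrow> \<sigma> x = f x"
    by blast
  have "\<sigma> x = y" if "(x, y) \<in> G" for x y
    using \<sigma>(2)[of x] elementary_single_valued[OF G(1) f that] that by auto
  then show thesis by (rule that[OF \<sigma>(1)])
qed


section \<open>Imaginaries as images of real tuples\<close>

text \<open>
  A sort of \<open>S\<^sup>e\<^sup>q\<close> is \<open>None\<close> (the home sort) or \<open>Some (n, E)\<close>.  Every imaginary is the image,
  under the projection onto its sort, of a real tuple of positive finite length.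
\<close>

type_synonym ('f, 'r) imag_sort = "(nat \<times> ('f, 'r) fm) option"

fun is_sort :: "('f, 'r) lang \<Rightarrow> ('f, 'r, 'a) struct \<Rightarrow> ('f, 'r) imag_sort \<Rightarrow> bool" where
  "is_sort L S None \<longleftrightarrow> True"
| "is_sort L S (Some (n, E)) \<longleftrightarrow> equiv_fm L S n E"

fun sort_arity :: "('f, 'r) imag_sort \<Rightarrow> nat" where
  "sort_arity None = 1"
| "sort_arity (Some (n, E)) = n"

fun imag_of :: "('f, 'r, 'a) struct \<Rightarrow> ('f, 'r) imag_sort \<Rightarrow> 'a list \<Rightarrow> ('f, 'r, 'a) imag" where
  "imag_of S None xs = Elem (hd xs)"
| "imag_of S (Some (n, E)) xs = class_of S n E xs"

lemma sort_arity_pos: "is_sort L S k \<Longrightarrow> 0 < sort_arity k"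
  by (cases k) (auto simp: equiv_fm_def)

lemma imaginaries_iff:
  "u \<in> imaginaries L S M \<longleftrightarrow>
    (\<exists>k xs. is_sort L S k \<and> xs \<in> tuples M (sort_arity k) \<and> u = imag_of S k xs)" (is "_ \<longleftrightarrow> ?R")
proof
  assume "u \<in> imaginaries L S M"
  then consider a where "a \<in> M" "u = Elem a"
    | n E xs where "equiv_fm L S n E" "xs \<in> tuples M n" "u = class_of S n E xs"
    by (auto simp: imaginaries_def)
  then show ?R
  proof cases
    case 1
    then show ?thesis by (intro exI[of _ None] exI[of _ "[a]"]) (auto simp: tuples_def)
  next
    case 2
    then show ?thesis by (intro exI[of _ "Some (n, E)"] exI[of _ xs]) auto
  qed
next
  assume ?R
  then obtain k xs where *: "is_sort L S k" "xs \<in> tuples M (sort_arity k)" "u = imag_of S k xs"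
    by blast
  show "u \<in> imaginaries L S M"
  proof (cases k)
    case None
    then have "hd xs \<in> M" using *(2) by (cases xs) (auto simp: tuples_def)
    then show ?thesis using * None by (auto simp: imaginaries_def)
  next
    case (Some nE)
    then show ?thesis using * by (cases nE) (auto simp: imaginaries_def)
  qed
qed

lemma univ_eq_struct [simp]: "univ (eq_struct L S) = imaginaries L S (univ S)"
  by (simp add: eq_struct_def)

lemma Elem_imaginaries: "X \<subseteq> M \<Longrightarrow> Elem ` X \<subseteq> imaginaries L S M"
  by (auto simp: imaginaries_def)

lemma tuples_mono: "A \<subseteq> B \<Longrightarrow> tuples A n \<subseteq> tuples B n"
  by (auto simp: tuples_def)

lemma imaginaries_mono: "A \<subseteq> B \<Longrightarrow> imaginaries L S A \<subseteq> imaginaries L S B"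
  using tuples_mono by (fastforce simp: imaginaries_iff)

lemma eq_struct_is_struct: "is_struct L S \<Longrightarrow> is_struct (eq_lang L S) (eq_struct L S)"
  by (auto simp: is_struct_def eq_lang_def imaginaries_def)

text \<open>The map of \<open>S\<^sup>e\<^sup>q\<close> induced by a map of \<open>S\<close>.\<close>

fun imag_map :: "('a \<Rightarrow> 'a) \<Rightarrow> ('f, 'r, 'a) imag \<Rightarrow> ('f, 'r, 'a) imag" where
  "imag_map \<sigma> (Elem a) = Elem (\<sigma> a)"
| "imag_map \<sigma> (Cls n E X) = Cls n E (map \<sigma> ` X)"

lemma map_automorphism_tuples:
  assumes "\<sigma> \<in> automorphisms L S" "xs \<in> tuples (univ S) n"
  shows "map \<sigma> xs \<in> tuples (univ S) n"
proof -
  have "\<sigma> x \<in> univ S" if "x \<in> set xs" for x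
    using that assms(2) by (intro automorphism_univ[OF assms(1)]) (auto simp: tuples_def)
  then show ?thesis using assms(2) by (auto simp: tuples_def)
qed

lemma tuples_automorphism:
  assumes "\<sigma> \<in> automorphisms L S"
  shows "map \<sigma> ` tuples (univ S) n = tuples (univ S) n"
proof -
  have onto: "\<sigma> ` univ S = univ S"
    using assms by (auto simp: automorphisms_def bij_betw_def)
  show ?thesis
  proof
    show "map \<sigma> ` tuples (univ S) n \<subseteq> tuples (univ S) n"
      using map_automorphism_tuples[OF assms] by blast
    show "tuples (univ S) n \<subseteq> map \<sigma> ` tuples (univ S) n"
    proof
      fix ys assume ys: "ys \<in> tuples (univ S) n"
      then have "ys \<in> lists (\<sigma> ` univ S)" unfolding onto by (auto simp: tuples_def)
      then obtain xs where "xs \<in> lists (univ S)" "ys = map \<sigma> xs"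
        unfolding lists_image by blast
      then show "ys \<in> map \<sigma> ` tuples (univ S) n"
        using ys by (auto simp: tuples_def)
    qed
  qed
qed

lemma imag_map_class_of:
  assumes S: "is_struct L S" and \<sigma>: "\<sigma> \<in> automorphisms L S"
    and E: "equiv_fm L S n E" and xs: "xs \<in> tuples (univ S) n"
  shows "imag_map \<sigma> (class_of S n E xs) = class_of S n E (map \<sigma> xs)"
proof -
  have *: "(map \<sigma> xs, map \<sigma> ys) \<in> defined_rel S n E \<longleftrightarrow> (xs, ys) \<in> defined_rel S n E"
    if ys: "ys \<in> tuples (univ S) n" for ys
  proof -
    have "sat S ((!) (map \<sigma> xs @ map \<sigma> ys)) E \<longleftrightarrow> sat S ((!) (xs @ ys)) E"
    proof (rule sat_automorphism[OF S \<sigma>])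
      show "is_fm L E" using E by (simp add: equiv_fm_def formulas_def)
      fix i assume "i \<in> fv E"
      then have "i < length (xs @ ys)"
        using E xs ys by (auto simp: equiv_fm_def tuples_def)
      then show "(xs @ ys) ! i \<in> univ S \<and> (map \<sigma> xs @ map \<sigma> ys) ! i = \<sigma> ((xs @ ys) ! i)"
        using xs ys nth_mem[of i "xs @ ys"] unfolding map_append[symmetric] tuples_def
        by (auto simp del: map_append)
    qed
    moreover have "map \<sigma> xs \<in> tuples (univ S) n" "map \<sigma> ys \<in> tuples (univ S) n"
      by (rule map_automorphism_tuples[OF \<sigma> xs], rule map_automorphism_tuples[OF \<sigma> ys])
    ultimately show ?thesis
      using xs ys by (simp add: defined_rel_def)
  qed
  have sub: "defined_rel S n E `` {zs} \<subseteq> tuples (univ S) n" for zs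
    by (auto simp: defined_rel_def)
  have "map \<sigma> ` (defined_rel S n E `` {xs}) = defined_rel S n E `` {map \<sigma> xs}"
  proof
    show "map \<sigma> ` (defined_rel S n E `` {xs}) \<subseteq> defined_rel S n E `` {map \<sigma> xs}"
      using * sub by blast
    show "defined_rel S n E `` {map \<sigma> xs} \<subseteq> map \<sigma> ` (defined_rel S n E `` {xs})"
    proof
      fix zs assume zs: "zs \<in> defined_rel S n E `` {map \<sigma> xs}"
      then have "zs \<in> map \<sigma> ` tuples (univ S) n"
        using sub unfolding tuples_automorphism[OF \<sigma>] by blast
      then obtain ys where "ys \<in> tuples (univ S) n" "zs = map \<sigma> ys"
        by blast
      then show "zs \<in> map \<sigma> ` (defined_rel S n E `` {xs})"
        using zs * by auto
    qed
  qed
  then show ?thesis by (simp add: class_of_def)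
qed

lemma imag_map_imag_of:
  assumes "is_struct L S" "\<sigma> \<in> automorphisms L S" "is_sort L S k" "xs \<in> tuples (univ S) (sort_arity k)"
  shows "imag_map \<sigma> (imag_of S k xs) = imag_of S k (map \<sigma> xs)"
proof (cases k)
  case None
  then show ?thesis using assms(4) by (cases xs) (auto simp: tuples_def)
next
  case (Some nE)
  then show ?thesis using assms by (cases nE) (auto intro: imag_map_class_of)
qed

lemma imag_map_inj:
  assumes \<sigma>: "\<sigma> \<in> automorphisms L S"
  shows "inj_on (imag_map \<sigma>) (imaginaries L S (univ S))"
proof -
  have "inj_on \<sigma> (univ S)" using \<sigma> by (auto simp: automorphisms_def bij_betw_def)
  then have inj: "inj_on (map \<sigma>) (lists (univ S))"
    by (auto intro!: inj_on_mapI elim: inj_on_subset)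
  have cls: "X \<subseteq> lists (univ S)" if "Cls n E X \<in> imaginaries L S (univ S)" for n E X
    using that by (auto simp: imaginaries_def class_of_def defined_rel_def tuples_def)
  show ?thesis
  proof (rule inj_onI)
    fix u w assume u: "u \<in> imaginaries L S (univ S)" and w: "w \<in> imaginaries L S (univ S)"
      and eq: "imag_map \<sigma> u = imag_map \<sigma> w"
    show "u = w"
    proof (cases u)
      case (Elem x)
      then obtain y where "w = Elem y" "\<sigma> x = \<sigma> y" using eq by (cases w) auto
      moreover have "x \<in> univ S" "y \<in> univ S"
        using u w Elem calculation(1) by (auto simp: imaginaries_def class_of_def)
      ultimately show ?thesis
        using \<open>inj_on \<sigma> (univ S)\<close> Elem by (simp add: inj_on_eq_iff)
    next
      case (Cls n E X)
      then obtain Y where "w = Cls n E Y" "map \<sigma> ` X = map \<sigma> ` Y"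
        using eq by (cases w) auto
      moreover have "X \<subseteq> lists (univ S)" "Y \<subseteq> lists (univ S)"
        using u w Cls calculation(1) by (auto dest!: cls)
      ultimately show ?thesis
        using inj_on_image_eq_iff[OF inj] Cls by simp
    qed
  qed
qed

lemma imag_map_automorphism:
  fixes L :: "('f, 'r) lang" and S :: "('f, 'r, 'a) struct"
  assumes S: "is_struct L S" and \<sigma>: "\<sigma> \<in> automorphisms L S"
  shows "imag_map \<sigma> \<in> automorphisms (eq_lang L S) (eq_struct L S)"
proof -
  let ?U = "imaginaries L S (univ S)"
  have inj: "inj_on (imag_map \<sigma>) ?U" by (rule imag_map_inj[OF \<sigma>])
  have onto: "imag_map \<sigma> ` ?U = ?U"
  proof
    show "imag_map \<sigma> ` ?U \<subseteq> ?U"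
    proof
      fix w :: "('f, 'r, 'a) imag" assume "w \<in> imag_map \<sigma> ` ?U"
      then obtain k xs where *: "is_sort L S k" "xs \<in> tuples (univ S) (sort_arity k)"
          "w = imag_map \<sigma> (imag_of S k xs)"
        by (auto simp: imaginaries_iff)
      then show "w \<in> ?U"
        unfolding imaginaries_iff imag_map_imag_of[OF S \<sigma> *(1,2)]
        using map_automorphism_tuples[OF \<sigma> *(2)] by blast
    qed
    show "?U \<subseteq> imag_map \<sigma> ` ?U"
    proof
      fix w assume "w \<in> ?U"
      then obtain k ys where *: "is_sort L S k" "ys \<in> tuples (univ S) (sort_arity k)"
          "w = imag_of S k ys"
        by (auto simp: imaginaries_iff)
      from *(2) have "ys \<in> map \<sigma> ` tuples (univ S) (sort_arity k)"
        by (simp only: tuples_automorphism[OF \<sigma>])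
      then obtain xs where xs: "xs \<in> tuples (univ S) (sort_arity k)" "ys = map \<sigma> xs"
        by blast
      then have "w = imag_map \<sigma> (imag_of S k xs)"
        using * imag_map_imag_of[OF S \<sigma> *(1) xs(1)] by simp
      moreover have "imag_of S k xs \<in> ?U"
        using *(1) xs(1) unfolding imaginaries_iff by blast
      ultimately show "w \<in> imag_map \<sigma> ` ?U" by blast
    qed
  qed
  \<comment> \<open>Each relation of \<open>S\<^sup>e\<^sup>q\<close> is the image of an invariant set of real tuples under an equivariant map.\<close>
  have rel: "(\<exists>xs\<in>tuples (univ S) n. map (imag_map \<sigma>) us = F xs \<and> R xs) \<longleftrightarrow>
      (\<exists>xs\<in>tuples (univ S) n. us = F xs \<and> R xs)"
    if us: "set us \<subseteq> ?U"
      and F: "\<And>xs. xs \<in> tuples (univ S) n \<Longrightarrow> set (F xs) \<subseteq> ?U \<and> map (imag_map \<sigma>) (F xs) = F (map \<sigma> xs)"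
      and R: "\<And>xs. xs \<in> tuples (univ S) n \<Longrightarrow> R (map \<sigma> xs) \<longleftrightarrow> R xs"
    for n us R and F :: "'a list \<Rightarrow> ('f, 'r, 'a) imag list"
  proof -
    have inj': "inj_on (map (imag_map \<sigma>)) (lists ?U)"
      using inj by (auto intro!: inj_on_mapI elim: inj_on_subset)
    have "(\<exists>xs\<in>tuples (univ S) n. map (imag_map \<sigma>) us = F xs \<and> R xs) \<longleftrightarrow>
        (\<exists>xs\<in>map \<sigma> ` tuples (univ S) n. map (imag_map \<sigma>) us = F xs \<and> R xs)"
      by (simp only: tuples_automorphism[OF \<sigma>])
    also have "\<dots> \<longleftrightarrow> (\<exists>xs\<in>tuples (univ S) n. map (imag_map \<sigma>) us = F (map \<sigma> xs) \<and> R (map \<sigma> xs))"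
      by (simp only: bex_simps)
    also have "\<dots> \<longleftrightarrow> (\<exists>xs\<in>tuples (univ S) n. us = F xs \<and> R xs)"
    proof (rule bex_cong[OF refl])
      fix xs assume xs: "xs \<in> tuples (univ S) n"
      have "us \<in> lists ?U" "F xs \<in> lists ?U" using us F[OF xs] by auto
      then have "map (imag_map \<sigma>) us = map (imag_map \<sigma>) (F xs) \<longleftrightarrow> us = F xs"
        by (rule inj_on_eq_iff[OF inj'])
      moreover have "map (imag_map \<sigma>) (F xs) = F (map \<sigma> xs)" using F[OF xs] by blast
      ultimately show "(map (imag_map \<sigma>) us = F (map \<sigma> xs) \<and> R (map \<sigma> xs)) \<longleftrightarrow> (us = F xs \<and> R xs)"
        using R[OF xs] by simp
    qed
    finally show ?thesis .
  qed
  have E: "set (map Elem xs) \<subseteq> ?U \<and> map (imag_map \<sigma>) (map Elem xs) = map Elem (map \<sigma> xs)"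
    if "xs \<in> tuples (univ S) n" for xs n
    using that by (auto simp: tuples_def imaginaries_def)
  have C: "class_of S n Q xs \<in> ?U \<and> imag_map \<sigma> (class_of S n Q xs) = class_of S n Q (map \<sigma> xs)"
    if "xs \<in> tuples (univ S) n" "equiv_fm L S n Q" for xs n Q
    using that imag_map_class_of[OF S \<sigma> that(2,1)] by (auto simp: imaginaries_def)
  have "rel_int (eq_struct L S) R (map (imag_map \<sigma>) us) \<longleftrightarrow> rel_int (eq_struct L S) R us"
    if R: "R \<in> rels (eq_lang L S)" and us: "set us \<subseteq> ?U" for R us
  proof (cases R)
    case Home_Sort
    have home: "(\<exists>x\<in>univ S. ws = [Elem x]) \<longleftrightarrow> (\<exists>xs\<in>tuples (univ S) 1. ws = map Elem xs \<and> True)"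
      for ws :: "('f, 'r, 'a) imag list"
      by (auto simp: tuples_def length_Suc_conv)
    have "(\<exists>xs\<in>tuples (univ S) 1. map (imag_map \<sigma>) us = map Elem xs \<and> True) \<longleftrightarrow>
        (\<exists>xs\<in>tuples (univ S) 1. us = map Elem xs \<and> True)"
      by (rule rel[OF us], erule E) simp
    then show ?thesis unfolding Home_Sort by (simp add: eq_struct_def home)
  next
    case (Quot_Sort n Q)
    then have Q: "equiv_fm L S n Q" using R by (auto simp: eq_lang_def)
    have "(\<exists>xs\<in>tuples (univ S) n. map (imag_map \<sigma>) us = [class_of S n Q xs] \<and> True) \<longleftrightarrow>
        (\<exists>xs\<in>tuples (univ S) n. us = [class_of S n Q xs] \<and> True)"
      by (rule rel[OF us]) (simp_all add: C Q)
    then show ?thesis unfolding Quot_Sort by (simp add: eq_struct_def)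
  next
    case (Base_Rel r)
    then have r: "r \<in> rels L" using R by (auto simp: eq_lang_def)
    have "(\<exists>xs\<in>tuples (univ S) (rel_arity L r). map (imag_map \<sigma>) us = map Elem xs \<and> rel_int S r xs) \<longleftrightarrow>
        (\<exists>xs\<in>tuples (univ S) (rel_arity L r). us = map Elem xs \<and> rel_int S r xs)"
      by (rule rel[OF us], erule E) (auto simp: tuples_def automorphism_rel[OF \<sigma> r])
    then show ?thesis unfolding Base_Rel by (simp add: eq_struct_def)
  next
    case (Base_Fun f)
    then have f: "f \<in> funs L" using R by (auto simp: eq_lang_def)
    have "(\<exists>xs\<in>tuples (univ S) (fun_arity L f).
          map (imag_map \<sigma>) us = map Elem xs @ [Elem (fun_int S f xs)] \<and> True) \<longleftrightarrow>
        (\<exists>xs\<in>tuples (univ S) (fun_arity L f). us = map Elem xs @ [Elem (fun_int S f xs)] \<and> True)"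
    proof (rule rel[OF us])
      fix xs assume xs: "xs \<in> tuples (univ S) (fun_arity L f)"
      then have "fun_int S f xs \<in> univ S" "fun_int S f (map \<sigma> xs) = \<sigma> (fun_int S f xs)"
        using is_struct_fun[OF S f] automorphism_fun[OF \<sigma> f] by (auto simp: tuples_def)
      then show "set (map Elem xs @ [Elem (fun_int S f xs)]) \<subseteq> ?U \<and>
          map (imag_map \<sigma>) (map Elem xs @ [Elem (fun_int S f xs)]) =
            map Elem (map \<sigma> xs) @ [Elem (fun_int S f (map \<sigma> xs))]"
        using E[OF xs] by (auto simp: imaginaries_def)
    qed simp
    then show ?thesis unfolding Base_Fun by (simp add: eq_struct_def)
  next
    case (Proj n Q)
    then have Q: "equiv_fm L S n Q" using R by (auto simp: eq_lang_def)
    have "(\<exists>xs\<in>tuples (univ S) n. map (imag_map \<sigma>) us = map Elem xs @ [class_of S n Q xs] \<and> True) \<longleftrightarrow>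
        (\<exists>xs\<in>tuples (univ S) n. us = map Elem xs @ [class_of S n Q xs] \<and> True)"
    proof (rule rel[OF us])
      fix xs assume xs: "xs \<in> tuples (univ S) n"
      show "set (map Elem xs @ [class_of S n Q xs]) \<subseteq> ?U \<and>
          map (imag_map \<sigma>) (map Elem xs @ [class_of S n Q xs]) =
            map Elem (map \<sigma> xs) @ [class_of S n Q (map \<sigma> xs)]"
        using E[OF xs] C[OF xs Q] by simp
    qed simp
    then show ?thesis unfolding Proj by (simp add: eq_struct_def)
  qed
  moreover have "funs (eq_lang L S) = {}" by (simp add: eq_lang_def)
  ultimately show ?thesis
    using inj onto by (simp add: automorphisms_def bij_betw_def)
qed


section \<open>Real types inside imaginary types\<close>

text \<open>
  A formula of \<open>S\<^sup>e\<^sup>q\<close> saying that the entries of a real tuple, given by a list of terms, have a given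
  projection.
\<close>

fun proj_fm :: "('f, 'r) imag_sort \<Rightarrow> 'g trm list \<Rightarrow> 'g trm \<Rightarrow> ('g, ('f, 'r) eq_sym) fm" where
  "proj_fm None ts t = Eq (hd ts) t"
| "proj_fm (Some (n, E)) ts t = Rl (Proj n E) (ts @ [t])"

lemma is_fm_proj_fm:
  "is_sort L S k \<Longrightarrow> length ts = sort_arity k \<Longrightarrow>
    (\<And>t. t \<in> set ts \<Longrightarrow> is_term (param_lang (eq_lang L S) B) t) \<Longrightarrow>
    is_term (param_lang (eq_lang L S) B) t \<Longrightarrow>
    is_fm (param_lang (eq_lang L S) B) (proj_fm k ts t)"
  by (cases k; cases ts) (auto simp: param_lang_def eq_lang_def)

lemma sat_proj_fm:
  assumes k: "is_sort L S k" and xs: "xs \<in> tuples (univ S) (sort_arity k)"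
    and ts: "map (eval (param_struct (eq_struct L S)) v) ts = map Elem xs"
  shows "sat (param_struct (eq_struct L S)) v (proj_fm k ts t) \<longleftrightarrow>
    eval (param_struct (eq_struct L S)) v t = imag_of S k xs"
proof (cases k)
  case None
  then obtain x where "xs = [x]" using xs by (auto simp: tuples_def length_Suc_conv)
  then show ?thesis using None ts by (cases ts) auto
next
  case (Some nE)
  obtain n E where nE: "nE = (n, E)" by (cases nE)
  have "map Elem xs = (map Elem ys :: ('a, 'b, 'c) imag list) \<longleftrightarrow> xs = ys" for ys
    by (intro inj_map_eq_map injI) simp
  then show ?thesis
    using xs ts unfolding Some nE by (auto simp: param_struct_def eq_struct_def)
qed

text \<open>
  A property of assignments into \<open>S\<close> is definable in \<open>S\<^sup>e\<^sup>q\<close>.  The language of \<open>S\<^sup>e\<^sup>q\<close> being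
  relational, nested terms are eliminated by quantifying over their values.
\<close>

definition eq_definable ::
  "('f, 'r) lang \<Rightarrow> ('f, 'r, 'a) struct \<Rightarrow> ('f, 'r, 'a) imag set \<Rightarrow> ((nat \<Rightarrow> 'a) \<Rightarrow> bool) \<Rightarrow> bool" where
  "eq_definable L S B Q \<longleftrightarrow>
     (\<exists>q. is_fm (param_lang (eq_lang L S) B) q \<and>
       (\<forall>v. range v \<subseteq> univ S \<longrightarrow> (sat (param_struct (eq_struct L S)) (Elem \<circ> v) q \<longleftrightarrow> Q v)))"

lemma eq_definableI:
  "is_fm (param_lang (eq_lang L S) B) q \<Longrightarrow>
    (\<And>v. range v \<subseteq> univ S \<Longrightarrow> sat (param_struct (eq_struct L S)) (Elem \<circ> v) q \<longleftrightarrow> Q v) \<Longrightarrow>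
    eq_definable L S B Q"
  unfolding eq_definable_def by blast

lemma eq_definable_cong:
  "eq_definable L S B Q \<Longrightarrow> (\<And>v. range v \<subseteq> univ S \<Longrightarrow> Q v \<longleftrightarrow> R v) \<Longrightarrow> eq_definable L S B R"
  by (auto simp: eq_definable_def)

lemma eq_definable_neg: "eq_definable L S B Q \<Longrightarrow> eq_definable L S B (\<lambda>v. \<not> Q v)"
  unfolding eq_definable_def by (metis is_fm.simps(3) sat.simps(3))

lemma eq_definable_conj:
  assumes "eq_definable L S B Q" "eq_definable L S B R"
  shows "eq_definable L S B (\<lambda>v. Q v \<and> R v)"
proof -
  obtain q r where "is_fm (param_lang (eq_lang L S) B) q" "is_fm (param_lang (eq_lang L S) B) r"
    "\<And>v. range v \<subseteq> univ S \<Longrightarrow> sat (param_struct (eq_struct L S)) (Elem \<circ> v) q \<longleftrightarrow> Q v"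
    "\<And>v. range v \<subseteq> univ S \<Longrightarrow> sat (param_struct (eq_struct L S)) (Elem \<circ> v) r \<longleftrightarrow> R v"
    using assms by (auto simp: eq_definable_def)
  then show ?thesis by (intro eq_definableI[where q = "Conj q r"]) simp_all
qed

lemma eq_definable_ex:
  fixes S :: "('f, 'r, 'a) struct"
  assumes "eq_definable L S B Q"
  shows "eq_definable L S B (\<lambda>v. \<exists>b\<in>univ S. Q (v(y := b)))"
proof -
  obtain q where q: "is_fm (param_lang (eq_lang L S) B) q"
    "\<And>v. range v \<subseteq> univ S \<Longrightarrow> sat (param_struct (eq_struct L S)) (Elem \<circ> v) q \<longleftrightarrow> Q v"
    using assms by (auto simp: eq_definable_def)
  show ?thesis
  proof (rule eq_definableI[where q = "Ex y (Conj (Rl Home_Sort [Var y]) q)"])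
    show "is_fm (param_lang (eq_lang L S) B) (Ex y (Conj (Rl Home_Sort [Var y]) q))"
      using q(1) by (simp add: param_lang_def eq_lang_def)
    fix v :: "nat \<Rightarrow> 'a" assume v: "range v \<subseteq> univ S"
    have "sat (param_struct (eq_struct L S)) (Elem \<circ> v) (Ex y (Conj (Rl Home_Sort [Var y]) q)) \<longleftrightarrow>
        (\<exists>b\<in>univ S. sat (param_struct (eq_struct L S)) ((Elem \<circ> v)(y := Elem b)) q)"
      by (auto simp: param_struct_def eq_struct_def imaginaries_def)
    also have "\<dots> \<longleftrightarrow> (\<exists>b\<in>univ S. Q (v(y := b)))"
    proof (rule bex_cong[OF refl])
      fix b assume "b \<in> univ S"
      then have rng: "range (v(y := b)) \<subseteq> univ S" using v by auto
      have upd: "(Elem \<circ> v)(y := Elem b) = Elem \<circ> v(y := b)" by (simp add: fun_upd_comp)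
      show "sat (param_struct (eq_struct L S)) ((Elem \<circ> v)(y := Elem b)) q \<longleftrightarrow> Q (v(y := b))"
        unfolding upd by (rule q(2)[OF rng])
    qed
    finally show "sat (param_struct (eq_struct L S)) (Elem \<circ> v) (Ex y (Conj (Rl Home_Sort [Var y]) q)) \<longleftrightarrow>
        (\<exists>b\<in>univ S. Q (v(y := b)))" .
  qed
qed

lemma param_eval_univ:
  assumes "is_struct L S" "is_term (param_lang L {}) t" "range v \<subseteq> univ S"
  shows "eval (param_struct S) v t \<in> univ S"
proof -
  have id: "(\<lambda>x. x) \<in> automorphisms (param_lang L {}) (param_struct S)"
    by (auto simp: automorphisms_def bij_betw_def)
  show ?thesis
    using eval_automorphism[OF param_struct_is_struct[OF assms(1)] id assms(2), of v v] assms(3)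
    by auto
qed

text \<open>
  The terms are replaced by fresh variables one by one; \<open>ys\<close> collects the variables already
  introduced.
\<close>

lemma eq_definable_terms:
  fixes S :: "('f, 'r, 'c) struct"
  assumes "is_struct L S"
    and "\<And>xs. length xs = length ys + length ts \<Longrightarrow> eq_definable L S B (\<lambda>v. Q (map v xs))"
    and "\<And>t x. t \<in> set ts \<Longrightarrow> eq_definable L S B (\<lambda>v. v x = eval (param_struct S) v t)"
    and "\<And>t. t \<in> set ts \<Longrightarrow> is_term (param_lang L {}) t"
  shows "eq_definable L S B (\<lambda>v. Q (map v ys @ map (eval (param_struct S) v) ts))"
  using assms(2-)
proof (induction ts arbitrary: ys)
  case Nil
  show ?case using Nil(1)[of ys] by (simp only: list.map append_Nil2 list.size)
next
  case (Cons t ts)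
  have "finite (set ys \<union> fv_trm t \<union> (\<Union>u\<in>set ts. fv_trm u))"
    by (simp add: finite_fv_trm)
  then have "\<exists>y. y \<notin> set ys \<union> fv_trm t \<union> (\<Union>u\<in>set ts. fv_trm u)"
    by (rule ex_new_if_finite[OF infinite_UNIV_nat])
  then obtain y where y: "y \<notin> set ys \<union> fv_trm t \<union> (\<Union>u\<in>set ts. fv_trm u)" ..
  let ?R = "\<lambda>v. Q (map v (ys @ [y]) @ map (eval (param_struct S) v) ts)"
  have "eq_definable L S B ?R"
  proof (rule Cons.IH)
    show "eq_definable L S B (\<lambda>v. Q (map v xs))" if "length xs = length (ys @ [y]) + length ts" for xs
      by (rule Cons.prems(1)) (simp add: that)
    show "eq_definable L S B (\<lambda>v. v x = eval (param_struct S) v u)" if "u \<in> set ts" for u x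
      by (rule Cons.prems(2)) (simp add: that)
    show "is_term (param_lang L {}) u" if "u \<in> set ts" for u
      by (rule Cons.prems(3)) (simp add: that)
  qed
  moreover have "eq_definable L S B (\<lambda>v. v y = eval (param_struct S) v t)"
    by (rule Cons.prems(2)) simp
  ultimately have "eq_definable L S B (\<lambda>v. ?R v \<and> v y = eval (param_struct S) v t)"
    by (rule eq_definable_conj)
  then have "eq_definable L S B
      (\<lambda>v. \<exists>b\<in>univ S. ?R (v(y := b)) \<and> (v(y := b)) y = eval (param_struct S) (v(y := b)) t)"
    by (rule eq_definable_ex)
  then show ?case
  proof (rule eq_definable_cong)
    fix v :: "nat \<Rightarrow> 'c" assume v: "range v \<subseteq> univ S"
    have t: "eval (param_struct S) v t \<in> univ S"
      by (rule param_eval_univ[OF assms(1) _ v]) (simp add: Cons.prems(3))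
    have 1: "eval (param_struct S) (v(y := b)) t = eval (param_struct S) v t" for b
      by (rule eval_cong) (use y in auto)
    have 2: "map (eval (param_struct S) (v(y := b))) ts = map (eval (param_struct S) v) ts" for b
      by (rule map_cong[OF refl], rule eval_cong) (use y in auto)
    have 3: "map (v(y := b)) (ys @ [y]) = map v ys @ [b]" for b
      using y by auto
    have "(\<exists>b\<in>univ S. ?R (v(y := b)) \<and> (v(y := b)) y = eval (param_struct S) (v(y := b)) t) \<longleftrightarrow>
        Q ((map v ys @ [eval (param_struct S) v t]) @ map (eval (param_struct S) v) ts)"
      unfolding 1 2 3 fun_upd_same using t by auto
    then show "(\<exists>b\<in>univ S. ?R (v(y := b)) \<and> (v(y := b)) y = eval (param_struct S) (v(y := b)) t) \<longleftrightarrow>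
        Q (map v ys @ map (eval (param_struct S) v) (t # ts))"
      by (simp only: list.map append.simps append_assoc)
  qed
qed

lemma eq_definable_term:
  fixes S :: "('f, 'r, 'a) struct"
  assumes S: "is_struct L S"
  shows "is_term (param_lang L {}) (t :: ('f + 'a) trm) \<Longrightarrow>
    eq_definable L S B (\<lambda>v. v x = eval (param_struct S) v t)"
proof (induction t arbitrary: x)
  case (Var y)
  show ?case by (rule eq_definableI[where q = "Eq (Var x) (Var y)"]) simp_all
next
  case (Fn g ts)
  from Fn.prems obtain f where g: "g = Inl f" and f: "f \<in> funs L" "length ts = fun_arity L f"
    by (auto simp: param_lang_def)
  let ?Q = "\<lambda>us. last us = fun_int S f (butlast us)"
  have "eq_definable L S B (\<lambda>v. ?Q (map v [] @ map (eval (param_struct S) v) (ts @ [Var x])))"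
  proof (rule eq_definable_terms[OF S])
    fix xs :: "nat list" assume "length xs = length [] + length (ts @ [Var x])"
    then have xs: "length xs = Suc (fun_arity L f)" by (simp add: f)
    show "eq_definable L S B (\<lambda>v. ?Q (map v xs))"
    proof (rule eq_definableI[where q = "Rl (Base_Fun f) (map Var xs)"])
      show "is_fm (param_lang (eq_lang L S) B) (Rl (Base_Fun f) (map Var xs))"
        using f xs by (auto simp: param_lang_def eq_lang_def)
      fix v :: "nat \<Rightarrow> 'a" assume v: "range v \<subseteq> univ S"
      have inj: "map Elem us = (map Elem ws :: ('f, 'r, 'a) imag list) \<longleftrightarrow> us = ws" for us ws
        by (intro inj_map_eq_map injI) simp
      have "sat (param_struct (eq_struct L S)) (Elem \<circ> v) (Rl (Base_Fun f) (map Var xs)) \<longleftrightarrow>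
          (\<exists>zs\<in>tuples (univ S) (fun_arity L f).
            map Elem (map v xs) = (map Elem (zs @ [fun_int S f zs]) :: ('f, 'r, 'a) imag list))"
        by (simp add: param_struct_def eq_struct_def comp_def)
      also have "\<dots> \<longleftrightarrow> (\<exists>zs\<in>tuples (univ S) (fun_arity L f). map v xs = zs @ [fun_int S f zs])"
        by (simp only: inj)
      also have "\<dots> \<longleftrightarrow> ?Q (map v xs)"
      proof
        assume q: "?Q (map v xs)"
        have ne: "map v xs \<noteq> []" using xs by auto
        have "butlast (map v xs) \<in> tuples (univ S) (fun_arity L f)"
          using range_subsetD[OF v] xs by (auto simp: tuples_def dest!: in_set_butlastD)
        moreover have "map v xs = butlast (map v xs) @ [fun_int S f (butlast (map v xs))]"
          unfolding q[symmetric] using append_butlast_last_id[OF ne] by simp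
        ultimately show "\<exists>zs\<in>tuples (univ S) (fun_arity L f). map v xs = zs @ [fun_int S f zs]"
          by blast
      qed auto
      finally show "sat (param_struct (eq_struct L S)) (Elem \<circ> v) (Rl (Base_Fun f) (map Var xs)) \<longleftrightarrow>
          ?Q (map v xs)" .
    qed
  next
    fix t y assume t: "t \<in> set (ts @ [Var x])"
    show "is_term (param_lang L {}) t" using t Fn.prems by auto
    show "eq_definable L S B (\<lambda>v. v y = eval (param_struct S) v t)"
    proof (cases "t \<in> set ts")
      case True
      then show ?thesis using Fn.prems by (intro Fn.IH) auto
    next
      case False
      then have "t = Var x" using t by simp
      then show ?thesis by (intro eq_definableI[where q = "Eq (Var y) (Var x)"]) simp_all
    qed
  qed
  then show ?case
    by (rule eq_definable_cong) (simp add: g param_struct_def)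
qed

lemma eq_definable_fm:
  fixes S :: "('f, 'r, 'a) struct"
  assumes S: "is_struct L S"
  shows "is_fm (param_lang L {}) (p :: ('f + 'a, 'r) fm) \<Longrightarrow>
    eq_definable L S B (\<lambda>v. sat (param_struct S) v p)"
proof (induction p)
  case (Eq t u)
  let ?Q = "\<lambda>us. us ! 0 = us ! 1"
  have "eq_definable L S B (\<lambda>v. ?Q (map v [] @ map (eval (param_struct S) v) [t, u]))"
  proof (rule eq_definable_terms[OF S])
    fix xs :: "nat list" assume "length xs = length [] + length [t, u]"
    then obtain x y where "xs = [x, y]" by (auto simp: length_Suc_conv)
    then show "eq_definable L S B (\<lambda>v. ?Q (map v xs))"
      by (intro eq_definableI[where q = "Eq (Var x) (Var y)"]) simp_all
  next
    fix s x assume "s \<in> set [t, u]"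
    then show s: "is_term (param_lang L {}) s" using Eq by auto
    show "eq_definable L S B (\<lambda>v. v x = eval (param_struct S) v s)"
      by (rule eq_definable_term[OF S s])
  qed
  then show ?case by (rule eq_definable_cong) simp
next
  case (Rl r ts)
  then have r: "r \<in> rels L" "length ts = rel_arity L r" by (auto simp: param_lang_def)
  let ?Q = "\<lambda>us. rel_int S r us"
  have "eq_definable L S B (\<lambda>v. ?Q (map v [] @ map (eval (param_struct S) v) ts))"
  proof (rule eq_definable_terms[OF S])
    fix xs :: "nat list" assume "length xs = length [] + length ts"
    then have xs: "length xs = rel_arity L r" by (simp add: r)
    show "eq_definable L S B (\<lambda>v. ?Q (map v xs))"
    proof (rule eq_definableI[where q = "Rl (Base_Rel r) (map Var xs)"])
      show "is_fm (param_lang (eq_lang L S) B) (Rl (Base_Rel r) (map Var xs))"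
        using r xs by (auto simp: param_lang_def eq_lang_def)
      fix v :: "nat \<Rightarrow> 'a" assume v: "range v \<subseteq> univ S"
      have inj: "map Elem us = (map Elem ws :: ('f, 'r, 'a) imag list) \<longleftrightarrow> us = ws" for us ws
        by (intro inj_map_eq_map injI) simp
      have "sat (param_struct (eq_struct L S)) (Elem \<circ> v) (Rl (Base_Rel r) (map Var xs)) \<longleftrightarrow>
          (\<exists>zs\<in>tuples (univ S) (rel_arity L r).
            map Elem (map v xs) = (map Elem zs :: ('f, 'r, 'a) imag list) \<and> rel_int S r zs)"
        by (simp add: param_struct_def eq_struct_def comp_def)
      also have "\<dots> \<longleftrightarrow> (\<exists>zs\<in>tuples (univ S) (rel_arity L r). map v xs = zs \<and> rel_int S r zs)"
        by (simp only: inj)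
      also have "\<dots> \<longleftrightarrow> ?Q (map v xs)"
        using range_subsetD[OF v] xs by (auto simp: tuples_def)
      finally show "sat (param_struct (eq_struct L S)) (Elem \<circ> v) (Rl (Base_Rel r) (map Var xs)) \<longleftrightarrow>
          ?Q (map v xs)" .
    qed
  next
    fix s x assume "s \<in> set ts"
    then show s: "is_term (param_lang L {}) s" using Rl by auto
    show "eq_definable L S B (\<lambda>v. v x = eval (param_struct S) v s)"
      by (rule eq_definable_term[OF S s])
  qed
  then show ?case by (rule eq_definable_cong) (simp add: param_struct_def)
next
  case (Neg p)
  then have "eq_definable L S B (\<lambda>v. sat (param_struct S) v p)" by simp
  from eq_definable_neg[OF this] show ?case by simp
next
  case (Conj p q)
  then have "eq_definable L S B (\<lambda>v. sat (param_struct S) v p)"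
    "eq_definable L S B (\<lambda>v. sat (param_struct S) v q)" by simp_all
  from eq_definable_conj[OF this] show ?case by simp
next
  case (Ex x p)
  then have "eq_definable L S B (\<lambda>v. sat (param_struct S) v p)" by simp
  from eq_definable_ex[OF this, of x] show ?case by simp
qed

lemma same_typeD:
  "same_type L S A I c c' \<Longrightarrow> is_fm (param_lang L A) p \<Longrightarrow> (\<And>n. s n \<in> I) \<Longrightarrow>
    sat (param_struct S) (\<lambda>n. c (s n)) p \<longleftrightarrow> sat (param_struct S) (\<lambda>n. c' (s n)) p"
  unfolding same_type_def formulas_def comp_def by blast

lemma same_type_trans:
  "same_type L S A I c d \<Longrightarrow> same_type L S A I d e \<Longrightarrow> same_type L S A I c e"
  by (simp add: same_type_def)

text \<open>
  An elementary map of \<open>S\<^sup>e\<^sup>q\<close> over \<open>B\<close> defined on a real set \<open>A\<close> is given by an elementary map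
  \<open>h\<close> of \<open>S\<close>, and \<open>h\<close> preserves the imaginaries in \<open>B\<close> that are represented by tuples from \<open>A\<close>.
\<close>

lemma same_type_real:
  fixes L :: "('f, 'r) lang" and S :: "('f, 'r, 'a) struct"
  assumes S: "is_struct L S" and A: "A \<subseteq> univ S"
    and g: "g ` Elem ` A \<subseteq> imaginaries L S (univ S)"
    and type: "same_type (eq_lang L S) (eq_struct L S) B (Elem ` A) (\<lambda>u. u) g"
  obtains h where "h ` A \<subseteq> univ S" "\<And>x. x \<in> A \<Longrightarrow> g (Elem x) = Elem (h x)"
    "elementary L S ((\<lambda>x. (x, h x)) ` A)"
    "\<And>k xs. is_sort L S k \<Longrightarrow> xs \<in> tuples A (sort_arity k) \<Longrightarrow> imag_of S k xs \<in> B \<Longrightarrow>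
      imag_of S k (map h xs) = imag_of S k xs"
proof -
  let ?EQ = "param_struct (eq_struct L S)" and ?LB = "param_lang (eq_lang L S) B"
  note type = same_typeD[OF type]
  have "\<exists>y\<in>univ S. g (Elem x) = Elem y" if x: "x \<in> A" for x
  proof -
    have home: "sat ?EQ (\<lambda>_. u) (Rl Home_Sort [Var 0]) \<longleftrightarrow> (\<exists>y\<in>univ S. u = Elem y)" for u
      by (simp add: param_struct_def eq_struct_def)
    have "is_fm ?LB (Rl Home_Sort [Var 0])" by (simp add: param_lang_def eq_lang_def)
    from type[OF this, of "\<lambda>_. Elem x"] show ?thesis
      using x A unfolding home by blast
  qed
  then obtain h where h: "\<And>x. x \<in> A \<Longrightarrow> h x \<in> univ S \<and> g (Elem x) = Elem (h x)"
    by metis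
  show thesis
  proof
    show "h ` A \<subseteq> univ S" using h by blast
    show "g (Elem x) = Elem (h x)" if "x \<in> A" for x using h that by blast
    show "elementary L S ((\<lambda>x. (x, h x)) ` A)"
      unfolding elementary_def
    proof (intro ballI allI impI)
      fix p :: "('f + 'a, 'r) fm" and s s' :: "nat \<Rightarrow> 'a"
      assume p: "p \<in> formulas (param_lang L {})" and ss: "\<forall>n. (s n, s' n) \<in> (\<lambda>x. (x, h x)) ` A"
      have s: "s n \<in> A" "s' n = h (s n)" for n using ss by auto
      obtain q where q: "is_fm ?LB q"
        "\<And>v. range v \<subseteq> univ S \<Longrightarrow> sat ?EQ (Elem \<circ> v) q \<longleftrightarrow> sat (param_struct S) v p"
        using eq_definable_fm[OF S, of p B] p by (auto simp: eq_definable_def formulas_def)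
      have "sat (param_struct S) s p \<longleftrightarrow> sat ?EQ (\<lambda>n. Elem (s n)) q"
        using q(2)[of s] s A by (auto simp: comp_def)
      also have "\<dots> \<longleftrightarrow> sat ?EQ (\<lambda>n. g (Elem (s n))) q"
        by (rule type[OF q(1)]) (simp add: s)
      also have "(\<lambda>n. g (Elem (s n))) = Elem \<circ> s'"
        using s h by auto
      also have "sat ?EQ (Elem \<circ> s') q \<longleftrightarrow> sat (param_struct S) s' p"
        using s h by (intro q(2)) auto
      finally show "sat (param_struct S) s p \<longleftrightarrow> sat (param_struct S) s' p" .
    qed
  next
    fix k xs assume k: "is_sort L S k" and xs: "xs \<in> tuples A (sort_arity k)"
      and B: "imag_of S k xs \<in> B"
    let ?n = "sort_arity k" and ?ts = "map Var [0..<sort_arity k]"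
    let ?t = "Fn (Inr (imag_of S k xs)) []" and ?p = "proj_fm k (map Var [0..<sort_arity k]) (Fn (Inr (imag_of S k xs)) [])"
    let ?s = "\<lambda>i. Elem (xs ! (if i < ?n then i else 0)) :: ('f, 'r, 'a) imag"
    have len: "length xs = ?n" "0 < ?n" using xs sort_arity_pos[OF k] by (auto simp: tuples_def)
    have inA: "xs ! i \<in> A" if "i < ?n" for i using xs len that by (auto simp: tuples_def)
    have p: "is_fm ?LB ?p"
      by (rule is_fm_proj_fm[OF k]) (auto simp: param_lang_def B)
    have t: "eval ?EQ v ?t = imag_of S k xs" for v by (simp add: param_struct_def)
    have "map (eval ?EQ ?s) ?ts = map Elem xs"
      using len by (intro nth_equalityI) auto
    moreover have "xs \<in> tuples (univ S) ?n" using xs A by (auto simp: tuples_def)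
    ultimately have "sat ?EQ ?s ?p"
      using sat_proj_fm[OF k] t by blast
    then have sat: "sat ?EQ (\<lambda>i. g (?s i)) ?p"
      using type[OF p, of ?s] inA len by auto
    have "map (eval ?EQ (\<lambda>i. g (?s i))) ?ts = map Elem (map h xs)"
      using len h inA by (intro nth_equalityI) auto
    moreover have "map h xs \<in> tuples (univ S) ?n" using xs h by (auto simp: tuples_def)
    ultimately have "sat ?EQ (\<lambda>i. g (?s i)) ?p \<longleftrightarrow>
        eval ?EQ (\<lambda>i. g (?s i)) ?t = imag_of S k (map h xs)"
      by (intro sat_proj_fm[OF k])
    then show "imag_of S k (map h xs) = imag_of S k xs"
      using sat unfolding t by simp
  qed
qed


section \<open>Calculus of independence\<close>

locale monster_independence = independence_relation +
  assumes mon: "Card_order mon" "infinite (Field mon)"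
begin

abbreviation "small \<equiv> small_in S mon"

lemma small_Un: "small A \<Longrightarrow> small B \<Longrightarrow> small (A \<union> B)"
  using card_of_Un_ordLess_infinite_Field[OF mon(2,1)] by (auto simp: small_in_def)

lemma small_subset: "small B \<Longrightarrow> A \<subseteq> B \<Longrightarrow> small A"
  unfolding small_in_def using card_of_mono1[of A B] ordLeq_ordLess_trans by blast

lemma small_singleton: "c \<in> univ S \<Longrightarrow> small {c}"
  unfolding small_in_def
  using finite_ordLess_infinite[OF card_of_Well_order card_order_on_well_order_on[OF mon(1)] _ mon(2), of "{c}"]
  by (simp add: Field_card_of)

lemma mono_left:
  assumes "small A" "small B" "small C" "ind A B C" "A' \<subseteq> A"
  shows "ind A' B C"
proof -
  have "ind A0 B C" if "finite A0" "A0 \<subseteq> A'" for A0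
    using finite_character[OF assms(1-3)] assms(4,5) that by auto
  then show ?thesis
    using finite_character[OF small_subset[OF assms(1,5)] assms(2,3)] by blast
qed

lemma mono_right:
  assumes "small A" "small B" "small C" "ind A B C" "C' \<subseteq> C"
  shows "ind A B C'"
  using symmetry[OF small_subset[OF assms(3,5)] assms(2,1)
      mono_left[OF assms(3,2,1) symmetry[OF assms(1-4)] assms(5)]] .

lemma normality_right:
  assumes "small A" "small B" "small C" "ind A B C"
  shows "ind A B (B \<union> C)"
proof -
  have "ind (C \<union> B) B A"
    by (rule normality[OF assms(3,1,2) symmetry[OF assms]])
  from symmetry[OF small_Un[OF assms(3,2)] assms(2,1) this] show ?thesis
    by (simp add: Un_commute)
qed

lemma base_mono:
  assumes "ind A B D" "small A" "small D" "B \<subseteq> C" "C \<subseteq> D"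
  shows "ind A C D"
  using transitivity[OF assms(2-5)] assms(1) by simp

lemma trans_right:
  assumes A: "small A" and B: "small B" and C: "small C" and D: "small D"
    and "ind A B C" "ind A (B \<union> C) D"
  shows "ind A B (C \<union> D)"
proof -
  note BC = small_Un[OF B C]
  note BCD = small_Un[OF BC D]
  have "ind A B (B \<union> C)" by (rule normality_right[OF A B C assms(5)])
  moreover have "ind A (B \<union> C) (B \<union> C \<union> D)" by (rule normality_right[OF A BC D assms(6)])
  ultimately have "ind A B (B \<union> C \<union> D)"
    using transitivity[OF A BCD, of B "B \<union> C"] by auto
  then show ?thesis by (rule mono_right[OF A B BCD]) auto
qed

lemma trans_left:
  assumes A: "small A" and B: "small B" and C: "small C" and D: "small D"
    and "ind A B C" "ind D (A \<union> B) C"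
  shows "ind (A \<union> D) B C"
proof -
  have "ind C (B \<union> A) D"
    using symmetry[OF D small_Un[OF A B] C assms(6)] by (simp add: Un_commute)
  from trans_right[OF C B A D symmetry[OF A B C assms(5)] this]
  show ?thesis by (rule symmetry[OF C B small_Un[OF A D]])
qed

text \<open>
  Every set is independent from the base.  By local character this needs no automorphisms of the
  structure.
\<close>

lemma existence:
  assumes "small A" "small B"
  shows "ind A B B"
proof -
  have "\<exists>B0\<subseteq>B. ind A B0 B"
    using local_character
  proof (elim exE conjE)
    fix l :: "'k rel"
    assume "\<forall>A C. small A \<and> small C \<longrightarrow> (\<exists>C0\<subseteq>C. |C0| <o l +c cardSuc |A| \<and> ind A C0 C)"
    from this[rule_format, OF conjI[OF assms]] show ?thesis by auto
  qed
  then obtain B0 where "B0 \<subseteq> B" "ind A B0 B" by auto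
  then show ?thesis by (intro base_mono[OF _ assms _ order_refl])
qed

text \<open>An element of the closure of \<open>B\<close> is independent from everything over \<open>B\<close>.\<close>

lemma cl_imp_ind:
  assumes c: "c \<in> cl S ind B" and B: "small B" and C: "small C"
  shows "ind {c} B C"
proof -
  have c': "small {c}" "ind {c} B {c}"
    using c small_singleton by (auto simp: cl_def)
  note Bc = small_Un[OF B c'(1)]
  have "ind C (B \<union> {c}) {c}"
    by (rule mono_right[OF C Bc Bc existence[OF C Bc]]) auto
  then have "ind {c} (B \<union> {c}) C" by (rule symmetry[OF C Bc c'(1)])
  from trans_right[OF c'(1) B c'(1) C c'(2) this]
  have "ind {c} B ({c} \<union> C)" .
  then show ?thesis by (rule mono_right[OF c'(1) B small_Un[OF c'(1) C]]) auto
qed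

lemma cl_mono:
  assumes "B \<subseteq> B'" "small B'"
  shows "cl S ind B \<subseteq> cl S ind B'"
proof
  fix c assume c: "c \<in> cl S ind B"
  then have c': "c \<in> univ S" "small {c}" using small_singleton by (auto simp: cl_def)
  note Bc = small_Un[OF assms(2) c'(2)]
  have "ind {c} B (B' \<union> {c})"
    by (rule cl_imp_ind[OF c small_subset[OF assms(2,1)] Bc])
  then have "ind {c} B' (B' \<union> {c})"
    by (rule base_mono) (use assms(1) c'(2) Bc in auto)
  then have "ind {c} B' {c}"
    by (rule mono_right[OF c'(2) assms(2) Bc]) auto
  then show "c \<in> cl S ind B'" using c' by (simp add: cl_def)
qed

lemma subset_cl_imp_ind:
  assumes X: "X \<subseteq> cl S ind B" "small X" and B: "small B" and C: "small C"
  shows "ind X B C"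
proof -
  have fin: "ind F B C" if "finite F" "F \<subseteq> cl S ind B" "small F" "small C" for F C
    using that
  proof (induction F arbitrary: C)
    case empty
    have "ind B B C"
      by (rule symmetry[OF empty(3) B B existence[OF empty(3) B]])
    then show ?case by (rule mono_left[OF B B empty(3)]) simp
  next
    case (insert c F)
    have F: "small F" by (rule small_subset[OF insert.prems(2)]) auto
    have c: "small {c}" by (rule small_subset[OF insert.prems(2)]) auto
    note Bc = small_Un[OF B c] and BcC = small_Un[OF small_Un[OF B c] insert.prems(3)]
    have "ind F B (B \<union> {c} \<union> C)"
      using insert.prems by (intro insert.IH F BcC) auto
    then have "ind F (B \<union> {c}) (B \<union> {c} \<union> C)"
      by (rule base_mono) (use F BcC in auto)
    then have "ind F (B \<union> {c}) C"
      by (rule mono_right[OF F Bc BcC]) auto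
    moreover have "ind {c} B C"
      using insert.prems by (intro cl_imp_ind B) auto
    ultimately have "ind ({c} \<union> F) B C"
      by (intro trans_left[OF c B insert.prems(3) F]) (simp_all add: Un_commute)
    then show ?case by simp
  qed
  have "ind A0 B C" if "finite A0" "A0 \<subseteq> X" for A0
    using that X small_subset[OF X(2)] C by (intro fin) auto
  then show ?thesis
    using finite_character[OF X(2) B C] by blast
qed

text \<open>The base may be enlarged inside the right-hand side together with part of the left-hand side.\<close>

lemma ind_move_to_base:
  assumes D: "small D" and A: "small A" and ind: "ind D B A" and B: "B \<subseteq> A"
    and D0: "D0 \<subseteq> D" and d: "d \<in> D"
  shows "ind {d} (B \<union> D0) (A \<union> D0)"
proof -
  note B' = small_subset[OF A B] and D0' = small_subset[OF D D0]
  note BD0 = small_Un[OF B' D0'] and BD = small_Un[OF B' D]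
  have d': "small {d}" by (rule small_subset[OF D]) (use d in simp)
  have "ind A B (B \<union> D)"
    by (rule normality_right[OF A B' D symmetry[OF D B' A ind]])
  then have "ind A (B \<union> D0) (B \<union> D)"
    by (rule base_mono) (use A BD D0 in auto)
  then have "ind A (B \<union> D0) {d}"
    by (rule mono_right[OF A BD0 BD]) (use d in simp)
  then have "ind {d} (B \<union> D0) A"
    by (rule symmetry[OF A BD0 d'])
  then have "ind {d} (B \<union> D0) ((B \<union> D0) \<union> A)"
    by (rule normality_right[OF d' BD0 A])
  moreover have "(B \<union> D0) \<union> A = A \<union> D0" using B by blast
  ultimately show ?thesis by simp
qed

text \<open>Changing the base to another one that contains it in its closure.\<close>

lemma ind_change_base:
  assumes D: "small D" and A: "small A" and Q: "small Q" and ind: "ind D Q A"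
    and W: "W \<subseteq> A" and cl: "Q \<subseteq> cl S ind W"
  shows "ind D W A"
proof -
  note W' = small_subset[OF A W] and QA = small_Un[OF Q A]
  note QW = small_Un[OF Q W']
  have "ind D Q (Q \<union> A)" by (rule normality_right[OF D Q A ind])
  then have "ind D (Q \<union> W) (Q \<union> A)"
    by (rule base_mono) (use D QA W in auto)
  then have DA: "ind D (Q \<union> W) A"
    by (rule mono_right[OF D QW QA]) auto
  have "ind Q W D" by (rule subset_cl_imp_ind[OF cl Q W' D])
  then have "ind D W Q" by (rule symmetry[OF Q W' D])
  then have "ind D W (Q \<union> A)"
    using DA by (intro trans_right[OF D W' Q A]) (simp_all add: Un_commute)
  then show ?thesis by (rule mono_right[OF D W' QA]) auto
qed

end


section \<open>Density for real tuples\<close>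

lemma realizing_density_type:
  fixes L :: "('f, 'r) lang" and S :: "('f, 'r, 'a) struct"
  assumes dens: "density_property L S ind \<kappa> M P"
    and B: "B \<subseteq> M" "|B| <o \<kappa>" and e: "e \<in> univ S" "ind {e} (P \<inter> B) B"
  obtains e' where "e' \<in> P"
    "\<And>p. is_fm (param_lang L B) p \<Longrightarrow> fv p \<subseteq> {0} \<Longrightarrow>
      sat (param_struct S) (\<lambda>_. e') p \<longleftrightarrow> sat (param_struct S) (\<lambda>_. e) p"
proof -
  define q where "q = {p \<in> one_formulas L B. sat (param_struct S) (\<lambda>_. e) p}"
  have real: "realizes S e F" if "F \<subseteq> q" for F
    unfolding realizes_def using that by (simp add: q_def subset_iff)
  have "q \<in> one_types L S B"
    using real e(1) by (auto simp: one_types_def q_def one_formulas_def formulas_def)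
  moreover have "type_indep S ind q (P \<inter> B) B"
    using real[OF order_refl] e by (auto simp: type_indep_def)
  ultimately obtain e' where e': "e' \<in> P" "realizes S e' q"
    using dens B unfolding density_property_def by blast
  have "sat (param_struct S) (\<lambda>_. e') p \<longleftrightarrow> sat (param_struct S) (\<lambda>_. e) p"
    if p: "is_fm (param_lang L B) p" "fv p \<subseteq> {0}" for p
  proof (cases "sat (param_struct S) (\<lambda>_. e) p")
    case True
    then have "p \<in> q" using p by (simp add: q_def one_formulas_def formulas_def)
    then show ?thesis using True e'(2) by (simp add: realizes_def)
  next
    case False
    then have "Neg p \<in> q" using p by (simp add: q_def one_formulas_def formulas_def)
    then have "sat (param_struct S) (\<lambda>_. e') (Neg p)" using e'(2) unfolding realizes_def by blast
    then show ?thesis using False by simp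
  qed
  then show thesis using that e'(1) by blast
qed

text \<open>
  The successor step: if \<open>e'\<close> realizes over the range of \<open>G\<close> the type of \<open>d\<close> transported along
  \<open>G\<close>, then \<open>d\<close> may be sent to \<open>e'\<close>.
\<close>

lemma elementary_insert:
  fixes L :: "('f, 'r) lang" and S :: "('f, 'r, 'a) struct"
  assumes S: "is_struct L S" and G: "G \<subseteq> univ S \<times> univ S" and \<sigma>: "\<sigma> \<in> automorphisms L S"
    and \<sigma>G: "\<And>x y. (x, y) \<in> G \<Longrightarrow> \<sigma> x = y" and d: "d \<in> univ S"
    and e': "\<And>p. is_fm (param_lang L (Range G)) p \<Longrightarrow> fv p \<subseteq> {0} \<Longrightarrow>
      sat (param_struct S) (\<lambda>_. e') p \<longleftrightarrow> sat (param_struct S) (\<lambda>_. \<sigma> d) p"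
  shows "elementary L S (insert (d, e') G)"
  unfolding elementary_def
proof (intro ballI allI impI)
  fix p :: "('f + 'a, 'r) fm" and s s' :: "nat \<Rightarrow> 'a"
  assume p: "p \<in> formulas (param_lang L {})" and ss: "\<forall>n. (s n, s' n) \<in> insert (d, e') G"
  \<comment> \<open>The entries in \<open>Range G\<close> become constants, the others are \<open>\<sigma> d\<close> and are identified in \<open>0\<close>.\<close>
  define \<tau> :: "nat \<Rightarrow> ('f + 'a) trm" where
    "\<tau> n = (if (s n, s' n) \<in> G then Fn (Inr (s' n)) [] else Var 0)" for n
  have \<tau>0: "fv_trm (\<tau> n) \<subseteq> {0}" for n by (simp add: \<tau>_def)
  have sub: "sat (param_struct S) v (subst \<tau> p) \<longleftrightarrow> sat (param_struct S) (\<lambda>n. eval (param_struct S) v (\<tau> n)) p" for v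
    using \<tau>0 by (intro sat_subst) blast
  have fm: "is_fm (param_lang L (Range G)) (subst \<tau> p)"
    using p by (intro is_fm_subst) (auto simp: formulas_def \<tau>_def param_lang_def)
  have fv: "fv (subst \<tau> p) \<subseteq> {0}"
    using fv_subst[of \<tau> p] \<tau>0 by blast
  have ev: "eval (param_struct S) (\<lambda>_. x) (\<tau> n) = (if (s n, s' n) \<in> G then s' n else x)" for x n
    by (simp add: \<tau>_def param_struct_def)
  have su: "s n \<in> univ S" for n using spec[OF ss, of n] G d by auto
  have id: "\<sigma> \<in> automorphisms (param_lang L {}) (param_struct S)"
    by (rule param_automorphism[OF \<sigma>]) simp
  have "sat (param_struct S) s p \<longleftrightarrow> sat (param_struct S) (\<lambda>n. \<sigma> (s n)) p"
    using sat_automorphism[OF param_struct_is_struct[OF S] id, of p s "\<lambda>n. \<sigma> (s n)"] p su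
    by (simp add: formulas_def)
  also have "(\<lambda>n. \<sigma> (s n)) = (\<lambda>n. eval (param_struct S) (\<lambda>_. \<sigma> d) (\<tau> n))"
    unfolding ev using spec[OF ss] \<sigma>G by (intro ext) (metis (mono_tags) Pair_inject insertE)
  also have "sat (param_struct S) \<dots> p \<longleftrightarrow> sat (param_struct S) (\<lambda>_. e') (subst \<tau> p)"
    using sub e'[OF fm fv] by simp
  also have "\<dots> \<longleftrightarrow> sat (param_struct S) (\<lambda>n. eval (param_struct S) (\<lambda>_. e') (\<tau> n)) p"
    by (rule sub)
  also have "(\<lambda>n. eval (param_struct S) (\<lambda>_. e') (\<tau> n)) = s'"
    unfolding ev by (rule ext) (use ss in auto)
  finally show "sat (param_struct S) s p \<longleftrightarrow> sat (param_struct S) s' p" .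
qed

text \<open>
  The density property for 1-types yields the one for real tuples: enumerating \<open>D\<close>, its elements
  are moved into \<open>P\<close> one after the other.  The transfinite recursion is replaced by a maximal
  elementary map that fixes \<open>A\<close> and sends elements of \<open>D\<close> into \<open>P\<close>.
\<close>

lemma (in monster_independence) density_real_tuple:
  assumes S: "is_struct L S" and hom: "strongly_homogeneous L S mon"
    and dens: "density_property L S ind \<kappa> M P" and M: "M \<subseteq> univ S" "P \<subseteq> M"
    and \<kappa>: "Card_order \<kappa>" "infinite (Field \<kappa>)" "\<kappa> <o mon"
    and A: "A \<subseteq> M" "|A| <o \<kappa>" and D: "D \<subseteq> univ S" "|D| <o \<kappa>"
    and ind: "ind D (P \<inter> A) A"
  obtains \<tau> where "\<tau> \<in> automorphisms L S" "\<And>x. x \<in> A \<Longrightarrow> \<tau> x = x" "\<tau> ` D \<subseteq> P"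
proof -
  have AD: "|A \<union> D| <o \<kappa>" by (rule card_of_Un_ordLess_infinite_Field[OF \<kappa>(2,1) A(2) D(2)])
  have sm: "small X" if "X \<subseteq> univ S" "|X| <o \<kappa>" for X
    using that ordLess_transitive[OF _ \<kappa>(3)] by (simp add: small_in_def)
  have smA: "small A" and smD: "small D" using A D M by (auto intro!: sm)
  define \<G> where "\<G> = {G. Id_on A \<subseteq> G \<and> G \<subseteq> Id_on A \<union> D \<times> P \<and> elementary L S G}"
  have "\<exists>G\<in>\<G>. \<forall>H\<in>\<G>. G \<subseteq> H \<longrightarrow> H = G"
  proof (rule subset_Zorn_nonempty)
    show "\<G> \<noteq> {}" using elementary_Id_on[of L S A] by (auto simp: \<G>_def)
    fix \<C> assume \<C>: "\<C> \<noteq> {}" "subset.chain \<G> \<C>"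
    then have sub: "\<C> \<subseteq> \<G>" by (simp add: subset.chain_def)
    have "elementary L S (\<Union>\<C>)"
      using \<C>(2) by (intro elementary_Union_chain) (auto simp: subset.chain_def \<G>_def)
    moreover have "Id_on A \<subseteq> \<Union>\<C>" "\<Union>\<C> \<subseteq> Id_on A \<union> D \<times> P"
      using sub \<C>(1) unfolding \<G>_def by blast+
    ultimately show "\<Union>\<C> \<in> \<G>" by (simp add: \<G>_def)
  qed
  then obtain G where "G \<in> \<G>" and max: "\<And>H. H \<in> \<G> \<Longrightarrow> G \<subseteq> H \<Longrightarrow> H = G" by blast
  then have G: "Id_on A \<subseteq> G" "G \<subseteq> Id_on A \<union> D \<times> P" "elementary L S G"
    by (auto simp: \<G>_def)
  have Gu: "G \<subseteq> univ S \<times> univ S" using G(2) A(1) D(1) M by blast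
  have Dom: "Domain G \<subseteq> A \<union> D" using G(2) by auto
  have Dom\<kappa>: "|Domain G| <o \<kappa>" using ordLeq_ordLess_trans[OF card_of_mono1[OF Dom] AD] .
  then have "|Domain G| <o mon" using \<kappa>(3) ordLess_transitive by blast
  from elementary_extends_to_automorphism[OF hom G(3) Gu this]
  obtain \<sigma> where \<sigma>: "\<sigma> \<in> automorphisms L S" "\<And>x y. (x, y) \<in> G \<Longrightarrow> \<sigma> x = y" by blast
  define D0 where "D0 = {x \<in> D. \<exists>y\<in>P. (x, y) \<in> G}"
  have dom: "Domain G = A \<union> D0" using G(1,2) by (auto simp: D0_def)
  have img: "\<sigma> ` (A \<union> D0) = Range G"
    using \<sigma>(2) unfolding dom[symmetric] by (auto simp: image_iff)
  have \<sigma>A: "\<sigma> x = x" if "x \<in> A" for x using \<sigma>(2)[of x x] G(1) that by auto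
  have \<sigma>D0: "\<sigma> x \<in> P" if "x \<in> D0" for x using \<sigma>(2) that by (auto simp: D0_def)
  have "d \<in> D0" if d: "d \<in> D" for d
  proof -
    have D0: "D0 \<subseteq> D" by (auto simp: D0_def)
    have du: "d \<in> univ S" using d D by auto
    have sm1: "small {d}" by (rule small_subset[OF smD]) (use d in simp)
    have sm2: "small (A \<union> D0)" by (rule small_subset[OF small_Un[OF smA smD]]) (use D0 in auto)
    have sm3: "small ((P \<inter> A) \<union> D0)" by (rule small_subset[OF sm2]) auto
    have smR: "small (Range G)"
      using sm2 Gu card_of_image[of \<sigma> "A \<union> D0"] ordLeq_ordLess_trans
      unfolding img small_in_def by blast
    have Rng: "Range G \<subseteq> M" using G(2) A M by auto
    have Rng\<kappa>: "|Range G| <o \<kappa>"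
      using ordLeq_ordLess_trans[OF card_of_image[of \<sigma> "A \<union> D0"]] Dom\<kappa> unfolding img dom by blast
    have "ind {d} ((P \<inter> A) \<union> D0) (A \<union> D0)"
      by (rule ind_move_to_base[OF smD smA ind _ D0 d]) auto
    from invariance[OF sm1 sm3 sm2 \<sigma>(1) this]
    have "ind {\<sigma> d} (\<sigma> ` ((P \<inter> A) \<union> D0)) (Range G)"
      unfolding img by simp
    then have "ind {\<sigma> d} (P \<inter> Range G) (Range G)"
    proof (rule base_mono)
      show "small {\<sigma> d}" by (rule small_singleton[OF automorphism_univ[OF \<sigma>(1) du]])
      show "small (Range G)" by (rule smR)
      show "\<sigma> ` ((P \<inter> A) \<union> D0) \<subseteq> P \<inter> Range G"
        using \<sigma>A \<sigma>D0 unfolding img[symmetric] by auto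
      show "P \<inter> Range G \<subseteq> Range G" by simp
    qed
    from realizing_density_type[OF dens Rng Rng\<kappa> automorphism_univ[OF \<sigma>(1) du] this]
    obtain e' where e': "e' \<in> P" "\<And>p. is_fm (param_lang L (Range G)) p \<Longrightarrow> fv p \<subseteq> {0} \<Longrightarrow>
      sat (param_struct S) (\<lambda>_. e') p \<longleftrightarrow> sat (param_struct S) (\<lambda>_. \<sigma> d) p" by blast
    have "elementary L S (insert (d, e') G)"
      by (rule elementary_insert[OF S Gu \<sigma> du e'(2)])
    then have "insert (d, e') G \<in> \<G>"
      using G d e'(1) by (auto simp: \<G>_def)
    then have "(d, e') \<in> G" using max by blast
    then show ?thesis using d e'(1) by (auto simp: D0_def)
  qed
  then have "\<sigma> ` D \<subseteq> P" using \<sigma>D0 by auto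
  then show thesis using that \<sigma>(1) \<sigma>A by blast
qed


section \<open>Imaginary tuples\<close>

text \<open>
  Because of the uniform bound \<open>\<kappa>0\<close> on the sets of the family, \<open>\<kappa>\<close> need not be regular.
\<close>

lemma card_of_UNION_ordLess:
  fixes \<kappa> :: "'k rel" and \<kappa>0 :: "'l rel"
  assumes \<kappa>: "Card_order \<kappa>" and \<kappa>0: "Card_order \<kappa>0" "infinite (Field \<kappa>0)" "\<kappa>0 <o \<kappa>"
    and I: "|I| <o \<kappa>" and A: "\<And>i. i \<in> I \<Longrightarrow> |A i| \<le>o \<kappa>0"
  shows "|\<Union>i\<in>I. A i| <o \<kappa>"
proof -
  have inf: "infinite (Field \<kappa>)"
    using cinfinite_mono[OF ordLess_imp_ordLeq[OF \<kappa>0(3)]] \<kappa>0(2) by (simp add: cinfinite_def)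
  have K: "|Field \<kappa>0| =o \<kappa>0" by (rule card_of_Field_ordIso[OF \<kappa>0(1)])
  have "|I <+> Field \<kappa>0| <o \<kappa>"
    by (rule card_of_Plus_ordLess_infinite_Field[OF inf \<kappa> I ordIso_ordLess_trans[OF K \<kappa>0(3)]])
  moreover have "|\<Union>i\<in>I. A i| \<le>o |I <+> Field \<kappa>0|"
  proof (rule card_of_UNION_ordLeq_infinite)
    show "infinite (I <+> Field \<kappa>0)" using \<kappa>0(2) by (simp add: finite_Plus_iff)
    show "|I| \<le>o |I <+> Field \<kappa>0|" by (rule card_of_Plus1)
    show "\<forall>i\<in>I. |A i| \<le>o |I <+> Field \<kappa>0|"
      using A ordLeq_transitive[OF _ ordIso_ordLeq_trans[OF ordIso_symmetric[OF K] card_of_Plus2]]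
      by blast
  qed
  ultimately show ?thesis by (rule ordLeq_ordLess_trans[rotated])
qed

lemma finite_ordLeq_infinite:
  "Card_order r \<Longrightarrow> infinite (Field r) \<Longrightarrow> finite A \<Longrightarrow> |A| \<le>o r"
  using finite_ordLess_infinite[OF card_of_Well_order card_order_on_well_order_on, of r A]
  by (auto simp: Field_card_of intro: ordLess_imp_ordLeq)

lemma imaginaries_representatives:
  assumes "c ` I \<subseteq> imaginaries L S M"
  obtains k xs where "\<And>i. i \<in> I \<Longrightarrow> is_sort L S (k i)"
    "\<And>i. i \<in> I \<Longrightarrow> xs i \<in> tuples (\<Union>i\<in>I. set (xs i)) (sort_arity (k i))"
    "\<And>i. i \<in> I \<Longrightarrow> c i = imag_of S (k i) (xs i)" "(\<Union>i\<in>I. set (xs i)) \<subseteq> M"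
proof -
  have "\<forall>i\<in>I. \<exists>k xs. is_sort L S k \<and> xs \<in> tuples M (sort_arity k) \<and> c i = imag_of S k xs"
    using assms imaginaries_iff by blast
  then obtain k xs where
    *: "\<forall>i\<in>I. is_sort L S (k i) \<and> xs i \<in> tuples M (sort_arity (k i)) \<and> c i = imag_of S (k i) (xs i)"
    by metis
  show thesis
  proof (rule that[of k xs])
    show "(\<Union>i\<in>I. set (xs i)) \<subseteq> M" using * by (auto simp: tuples_def)
    show "xs i \<in> tuples (\<Union>i\<in>I. set (xs i)) (sort_arity (k i))" if "i \<in> I" for i
      using * that by (auto simp: tuples_def)
  qed (use * in auto)
qed

locale imaginary_independence =
  real: monster_independence L S mon ind +
  imag: monster_independence "eq_lang L S" "eq_struct L S" mon ind_eq
  for L :: "('f, 'r) lang" and S :: "('f, 'r, 'a) struct" and mon :: "'k rel" and ind ind_eq +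
  assumes struct: "is_struct L S"
    and hom: "strongly_homogeneous L S mon"
    and extends: "extends_to_eq S mon ind ind_eq"
begin

lemma small_Elem:
  assumes "real.small X"
  shows "imag.small (Elem ` X)"
proof -
  have "X \<subseteq> univ S" "|X| <o mon" using assms by (simp_all add: small_in_def)
  then show ?thesis
    unfolding small_in_def univ_eq_struct
    by (intro conjI Elem_imaginaries ordLeq_ordLess_trans[OF card_of_image])
qed

lemma real_small: "X \<subseteq> univ S \<Longrightarrow> |X| <o \<kappa> \<Longrightarrow> \<kappa> <o mon \<Longrightarrow> real.small X"
  unfolding small_in_def using ordLess_transitive by blast

text \<open>An imaginary is definable over its representatives, so it is in their closure.\<close>

lemma imag_of_ind:
  assumes k: "is_sort L S k" and xs: "xs \<in> tuples X (sort_arity k)" and X: "X \<subseteq> univ S"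
    and B: "Elem ` X \<subseteq> B" "imag.small B" and C: "imag.small C"
  shows "ind_eq {imag_of S k xs} B C"
proof -
  let ?u = "imag_of S k xs" and ?EQ = "param_struct (eq_struct L S)"
  let ?p = "proj_fm k (map (\<lambda>x. Fn (Inr (Elem x)) []) xs) (Var 0)"
  have xs': "xs \<in> tuples (univ S) (sort_arity k)" using xs tuples_mono[OF X] by blast
  have "?u \<in> imaginaries L S (univ S)"
    using k xs' unfolding imaginaries_iff by blast
  then have "imag.small {?u}" by (intro imag.small_singleton) simp
  from imag.extension[OF this B(2) C] obtain g where
    type: "same_type (eq_lang L S) (eq_struct L S) B {?u} (\<lambda>u. u) g" and g: "ind_eq (g ` {?u}) B C"
    by blast
  have sat: "sat ?EQ v ?p \<longleftrightarrow> eval ?EQ v (Var 0) = ?u" for v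
    by (rule sat_proj_fm[OF k xs']) (simp add: param_struct_def)
  have "Elem x \<in> B" if "x \<in> set xs" for x using that xs B(1) by (auto simp: tuples_def)
  then have "is_fm (param_lang (eq_lang L S) B) ?p"
    using xs by (intro is_fm_proj_fm[OF k]) (auto simp: param_lang_def tuples_def)
  from same_typeD[OF type this, of "\<lambda>_. ?u"] have "g ?u = ?u"
    unfolding sat by simp
  then show ?thesis using g by simp
qed

lemma imag_of_in_cl:
  assumes "is_sort L S k" "xs \<in> tuples X (sort_arity k)" "real.small X"
  shows "imag_of S k xs \<in> cl (eq_struct L S) ind_eq (Elem ` X)"
proof -
  have X: "X \<subseteq> univ S" using assms(3) by (simp add: small_in_def)
  then have u: "imag_of S k xs \<in> univ (eq_struct L S)"
    using assms(1,2) tuples_mono[OF X] unfolding univ_eq_struct imaginaries_iff by blast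
  have "ind_eq {imag_of S k xs} (Elem ` X) {imag_of S k xs}"
    by (rule imag_of_ind[OF assms(1,2) X order_refl small_Elem[OF assms(3)] imag.small_singleton[OF u]])
  then show ?thesis using u by (simp add: cl_def)
qed

text \<open>
  If a tuple of imaginaries is independent from \<open>A\<close> over \<open>Q\<close>, then its representatives can be chosen
  to be independent from \<open>A\<close> over \<open>Q\<close> as well.
\<close>

lemma independent_representatives:
  assumes \<kappa>: "Card_order \<kappa>" "\<kappa> <o mon" and \<kappa>0: "Card_order \<kappa>0" "infinite (Field \<kappa>0)" "\<kappa>0 <o \<kappa>"
    and I: "|I| <o \<kappa>" and c: "c ` I \<subseteq> imaginaries L S (univ S)"
    and Q: "imag.small Q" and A: "imag.small A" and ind: "ind_eq (c ` I) Q A"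
  obtains D k xs where "D \<subseteq> univ S" "|D| <o \<kappa>" "ind_eq (Elem ` D) Q A"
    "\<And>i. i \<in> I \<Longrightarrow> is_sort L S (k i)" "\<And>i. i \<in> I \<Longrightarrow> xs i \<in> tuples D (sort_arity (k i))"
    "\<And>i. i \<in> I \<Longrightarrow> c i = imag_of S (k i) (xs i)"
proof -
  obtain k ys where k: "\<And>i. i \<in> I \<Longrightarrow> is_sort L S (k i)"
    and ys: "\<And>i. i \<in> I \<Longrightarrow> ys i \<in> tuples (\<Union>i\<in>I. set (ys i)) (sort_arity (k i))"
    and cy: "\<And>i. i \<in> I \<Longrightarrow> c i = imag_of S (k i) (ys i)" and sub: "(\<Union>i\<in>I. set (ys i)) \<subseteq> univ S"
    using imaginaries_representatives[OF c] by blast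
  define D0 where "D0 = (\<Union>i\<in>I. set (ys i))"
  note ys = ys[folded D0_def] and D0u = sub[folded D0_def]
  have D0: "|D0| <o \<kappa>"
    unfolding D0_def
    by (rule card_of_UNION_ordLess[OF \<kappa>(1) \<kappa>0 I]) (rule finite_ordLeq_infinite[OF \<kappa>0(1,2)], simp)
  have smD0: "imag.small (Elem ` D0)" by (rule small_Elem[OF real_small[OF D0u D0 \<kappa>(2)]])
  have smc: "imag.small (c ` I)"
    using c ordLeq_ordLess_trans[OF card_of_image ordLess_transitive[OF I \<kappa>(2)]]
    by (simp add: small_in_def)
  from imag.extension[OF smD0 imag.small_Un[OF smc Q] A] obtain g where
    g: "g ` Elem ` D0 \<subseteq> imaginaries L S (univ S)"
      "same_type (eq_lang L S) (eq_struct L S) (c ` I \<union> Q) (Elem ` D0) (\<lambda>u. u) g"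
      "ind_eq (g ` Elem ` D0) (c ` I \<union> Q) A"
    by auto
  obtain h where
    h: "h ` D0 \<subseteq> univ S" "\<And>x. x \<in> D0 \<Longrightarrow> g (Elem x) = Elem (h x)" "elementary L S ((\<lambda>x. (x, h x)) ` D0)"
    and fix_imag: "\<And>k xs. is_sort L S k \<Longrightarrow> xs \<in> tuples D0 (sort_arity k) \<Longrightarrow>
      imag_of S k xs \<in> c ` I \<union> Q \<Longrightarrow> imag_of S k (map h xs) = imag_of S k xs"
    by (rule same_type_real[OF struct D0u g(1,2)]) (rule that)
  have gh: "g ` Elem ` D0 = Elem ` h ` D0" using h(2) by (auto simp: image_iff)
  have hD0: "|h ` D0| <o \<kappa>" using ordLeq_ordLess_trans[OF card_of_image D0] .
  have smh: "imag.small (Elem ` h ` D0)" by (rule small_Elem[OF real_small[OF h(1) hD0 \<kappa>(2)]])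
  have "ind_eq (c ` I \<union> Elem ` h ` D0) Q A"
    using g(3) unfolding gh by (rule imag.trans_left[OF smc Q A smh ind])
  then have "ind_eq (Elem ` h ` D0) Q A"
    by (rule imag.mono_left[OF imag.small_Un[OF smc smh] Q A]) simp
  then show thesis
  proof (rule that[OF h(1) hD0])
    show "map h (ys i) \<in> tuples (h ` D0) (sort_arity (k i))" if "i \<in> I" for i
      using ys[OF that] by (auto simp: tuples_def)
    show "c i = imag_of S (k i) (map h (ys i))" if "i \<in> I" for i
    proof -
      have "imag_of S (k i) (ys i) \<in> c ` I \<union> Q"
        unfolding cy[OF that, symmetric] using that by blast
      from fix_imag[OF k[OF that] ys[OF that] this] show ?thesis
        unfolding cy[OF that] by (rule sym)
    qed
  qed (rule k)
qed

text \<open>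
  Very few elements of \<open>P\<close> suffice to have given very few imaginaries from the closure of \<open>P\<close> in
  their closure.  As \<open>\<kappa>0\<close> is a bound for finite real tuples, it is applied to representatives.
\<close>

lemma small_closure_base:
  assumes \<kappa>: "Card_order \<kappa>" "\<kappa> <o mon" and \<kappa>0: "local_bound S mon ind \<kappa>0" "\<kappa>0 <o \<kappa>"
    and Q: "|Q| <o \<kappa>" "Q \<subseteq> cl (eq_struct L S) ind_eq (Elem ` P)" and P: "real.small P"
  obtains P0 where "P0 \<subseteq> P" "|P0| <o \<kappa>" "Q \<subseteq> cl (eq_struct L S) ind_eq (Elem ` P0)"
proof -
  have \<kappa>0': "Card_order \<kappa>0" "infinite (Field \<kappa>0)"
    using \<kappa>0(1) by (auto simp: local_bound_def)
  have EP: "imag.small (Elem ` P)" by (rule small_Elem[OF P])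
  have ex: "\<exists>P0\<subseteq>P. |P0| <o \<kappa>0 \<and> u \<in> cl (eq_struct L S) ind_eq (Elem ` P0)" if u: "u \<in> Q" for u
  proof -
    have ucl: "u \<in> cl (eq_struct L S) ind_eq (Elem ` P)" using u Q(2) by blast
    then have uu: "u \<in> univ (eq_struct L S)" and u': "imag.small {u}" "ind_eq {u} (Elem ` P) {u}"
      using imag.small_singleton by (auto simp: cl_def)
    obtain k xs where k: "is_sort L S k" and xs: "xs \<in> tuples (univ S) (sort_arity k)"
      and uk: "u = imag_of S k xs"
      using uu unfolding univ_eq_struct imaginaries_iff by blast
    define X where "X = set xs"
    have X: "finite X" "X \<subseteq> univ S" "xs \<in> tuples X (sort_arity k)"
      using xs by (auto simp: X_def tuples_def)
    have "|X| <o mon"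
      using finite_ordLeq_infinite[OF \<kappa>0' X(1)] ordLess_transitive[OF \<kappa>0(2) \<kappa>(2)]
      by (rule ordLeq_ordLess_trans)
    then have smX: "real.small X" using X by (simp add: small_in_def)
    obtain P0 where P0: "P0 \<subseteq> P" "|P0| <o \<kappa>0" "ind X P0 P"
      using \<kappa>0(1) X P unfolding local_bound_def by blast
    have smP0: "real.small P0" by (rule real.small_subset[OF P P0(1)])
    have sm: "imag.small (Elem ` X)" "imag.small (Elem ` P0)"
      by (rule small_Elem[OF smX], rule small_Elem[OF smP0])
    have "ind_eq (Elem ` X) (Elem ` P0) (Elem ` P)"
      using extends P0(3) smX smP0 P by (simp add: extends_to_eq_def)
    moreover have "ind_eq {u} (Elem ` X \<union> Elem ` P0) (Elem ` P)"
      unfolding uk by (rule imag_of_ind[OF k X(3,2) _ imag.small_Un[OF sm] EP]) simp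
    ultimately have "ind_eq (Elem ` X \<union> {u}) (Elem ` P0) (Elem ` P)"
      by (rule imag.trans_left[OF sm EP u'(1)])
    then have "ind_eq {u} (Elem ` P0) (Elem ` P)"
      by (rule imag.mono_left[OF imag.small_Un[OF sm(1) u'(1)] sm(2) EP]) simp
    moreover have "ind_eq {u} (Elem ` P0 \<union> Elem ` P) {u}"
      using u'(2) P0(1) by (simp add: Un_absorb1 image_mono)
    ultimately have "ind_eq {u} (Elem ` P0) (Elem ` P \<union> {u})"
      by (rule imag.trans_right[OF u'(1) sm(2) EP u'(1)])
    then have "ind_eq {u} (Elem ` P0) {u}"
      by (rule imag.mono_right[OF u'(1) sm(2) imag.small_Un[OF EP u'(1)]]) simp
    then show ?thesis using P0 uu by (auto simp: cl_def)
  qed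
  then obtain f where f: "\<And>u. u \<in> Q \<Longrightarrow> f u \<subseteq> P \<and> |f u| <o \<kappa>0 \<and> u \<in> cl (eq_struct L S) ind_eq (Elem ` f u)"
    by metis
  show thesis
  proof
    show sub: "(\<Union>u\<in>Q. f u) \<subseteq> P" using f by blast
    show "|\<Union>u\<in>Q. f u| <o \<kappa>"
      by (rule card_of_UNION_ordLess[OF \<kappa>(1) \<kappa>0' \<kappa>0(2) Q(1)]) (use f ordLess_imp_ordLeq in blast)
    show "Q \<subseteq> cl (eq_struct L S) ind_eq (Elem ` (\<Union>u\<in>Q. f u))"
    proof
      fix u assume u: "u \<in> Q"
      have "imag.small (Elem ` (\<Union>u\<in>Q. f u))"
        by (rule small_Elem[OF real.small_subset[OF P sub]])
      then have "cl (eq_struct L S) ind_eq (Elem ` f u) \<subseteq> cl (eq_struct L S) ind_eq (Elem ` (\<Union>u\<in>Q. f u))"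
        using u by (intro imag.cl_mono) auto
      then show "u \<in> cl (eq_struct L S) ind_eq (Elem ` (\<Union>u\<in>Q. f u))" using f[OF u] by blast
    qed
  qed
qed

text \<open>
  A real set \<open>D\<close> can be moved over \<open>U\<close> to become independent from a real set \<open>A\<close> over which \<open>U\<close> is
  definable.  Instead of \<open>D\<close>, extension is applied to \<open>A\<close>: an elementary map of \<open>A\<close> over \<open>U\<close> comes
  from a real automorphism, and this automorphism fixes \<open>U\<close> since it fixes representatives of it.
  So no homogeneity of \<open>S\<^sup>e\<^sup>q\<close> is needed.
\<close>

lemma independent_conjugate:
  assumes A: "real.small A" and D: "real.small D" and U: "imag.small U" and Q: "Q \<subseteq> U"
    and rep: "\<And>u. u \<in> U \<Longrightarrow> \<exists>k xs. is_sort L S k \<and> xs \<in> tuples A (sort_arity k) \<and> u = imag_of S k xs"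
    and ind: "ind_eq (Elem ` D) Q U"
  obtains \<sigma> where "\<sigma> \<in> automorphisms L S" "\<And>u. u \<in> U \<Longrightarrow> imag_map \<sigma> u = u"
    "ind_eq (Elem ` \<sigma> ` D) Q (Elem ` A)"
proof -
  have Au: "A \<subseteq> univ S" and Du: "D \<subseteq> univ S" using A D by (auto simp: small_in_def)
  note EA = small_Elem[OF A] and ED = small_Elem[OF D] and Q' = imag.small_subset[OF U Q]
  from imag.extension[OF EA U ED] obtain g where
    g: "g ` Elem ` A \<subseteq> imaginaries L S (univ S)"
      "same_type (eq_lang L S) (eq_struct L S) U (Elem ` A) (\<lambda>u. u) g"
      "ind_eq (g ` Elem ` A) U (Elem ` D)"
    by auto
  obtain h where
    h: "h ` A \<subseteq> univ S" "\<And>x. x \<in> A \<Longrightarrow> g (Elem x) = Elem (h x)"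
    and el: "elementary L S ((\<lambda>x. (x, h x)) ` A)"
    and fix_imag: "\<And>k xs. is_sort L S k \<Longrightarrow> xs \<in> tuples A (sort_arity k) \<Longrightarrow>
      imag_of S k xs \<in> U \<Longrightarrow> imag_of S k (map h xs) = imag_of S k xs"
    by (rule same_type_real[OF struct Au g(1,2)]) (rule that)
  have gh: "g ` Elem ` A = Elem ` h ` A" using h(2) by (auto simp: image_iff)
  have smh: "real.small (h ` A)"
    using h(1) A ordLeq_ordLess_trans[OF card_of_image] by (auto simp: small_in_def)
  have conv: "((\<lambda>x. (x, h x)) ` A)\<inverse> = (\<lambda>x. (h x, x)) ` A" by auto
  have "elementary L S ((\<lambda>x. (h x, x)) ` A)"
    using elementary_converse[OF el] unfolding conv .
  moreover have "(\<lambda>x. (h x, x)) ` A \<subseteq> univ S \<times> univ S" using h(1) Au by auto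
  moreover have "|Domain ((\<lambda>x. (h x, x)) ` A)| <o mon"
    using smh by (simp add: small_in_def Domain_fst image_image)
  ultimately obtain \<sigma> where \<sigma>: "\<sigma> \<in> automorphisms L S"
      "\<And>x y. (x, y) \<in> (\<lambda>x. (h x, x)) ` A \<Longrightarrow> \<sigma> x = y"
    using elementary_extends_to_automorphism[OF hom] by blast
  have \<sigma>h: "\<sigma> (h x) = x" if "x \<in> A" for x using \<sigma>(2) that by blast
  have fixU: "imag_map \<sigma> u = u" if "u \<in> U" for u
  proof -
    obtain k xs where k: "is_sort L S k" and xs: "xs \<in> tuples A (sort_arity k)" and u: "u = imag_of S k xs"
      using rep[OF \<open>u \<in> U\<close>] by blast
    have "u = imag_of S k (map h xs)"
      using fix_imag[OF k xs that[unfolded u]] unfolding u by (rule sym)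
    moreover have "map h xs \<in> tuples (univ S) (sort_arity k)"
      using xs h(1) by (auto simp: tuples_def)
    moreover have "map \<sigma> (map h xs) = xs"
      unfolding map_map by (rule map_idI) (use xs \<sigma>h in \<open>auto simp: tuples_def\<close>)
    ultimately show ?thesis
      using imag_map_imag_of[OF struct \<sigma>(1) k] u by metis
  qed
  have \<sigma>eq: "imag_map \<sigma> \<in> automorphisms (eq_lang L S) (eq_struct L S)"
    by (rule imag_map_automorphism[OF struct \<sigma>(1)])
  have img: "imag_map \<sigma> ` U = U" "imag_map \<sigma> ` Q = Q"
    using fixU Q by (force simp: image_iff)+
  have imgE: "imag_map \<sigma> ` Elem ` X = Elem ` \<sigma> ` X" for X by (simp add: image_image)
  have imgA: "\<sigma> ` h ` A = A" using \<sigma>h by (force simp: image_iff)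
  have smD: "imag.small (Elem ` \<sigma> ` D)"
  proof (rule small_Elem)
    show "real.small (\<sigma> ` D)"
      using D automorphism_univ[OF \<sigma>(1)] ordLeq_ordLess_trans[OF card_of_image]
      by (auto simp: small_in_def)
  qed
  have 1: "ind_eq (Elem ` \<sigma> ` D) Q U"
    using imag.invariance[OF ED Q' U \<sigma>eq ind] by (simp only: img imgE)
  have "ind_eq (Elem ` h ` A) U (Elem ` D)" using g(3) unfolding gh .
  from imag.invariance[OF small_Elem[OF smh] U ED \<sigma>eq this]
  have "ind_eq (Elem ` A) U (Elem ` \<sigma> ` D)" by (simp only: img imgE imgA)
  then have 2: "ind_eq (Elem ` \<sigma> ` D) U (Elem ` A)" by (rule imag.symmetry[OF EA U smD])
  have "ind_eq (Elem ` \<sigma> ` D) Q (U \<union> Elem ` A)"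
    using 1 2 Q by (intro imag.trans_right[OF smD Q' U EA]) (simp_all add: Un_absorb1)
  then have "ind_eq (Elem ` \<sigma> ` D) Q (Elem ` A)"
    by (rule imag.mono_right[OF smD Q' imag.small_Un[OF U EA]]) simp
  then show thesis using that[OF \<sigma>(1)] fixU by blast
qed

end


theorem lemma5p5:
  fixes L :: "('f, 'r) lang"
    and T :: "('f, 'r) fm set"
    and \<CC> :: "('f, 'r, 'a) struct"
    and mon \<kappa>0 \<kappa> :: "'k rel"
    and ind :: "'a set \<Rightarrow> 'a set \<Rightarrow> 'a set \<Rightarrow> bool"
    and ind_eq :: "('f, 'r, 'a) imag set \<Rightarrow> ('f, 'r, 'a) imag set \<Rightarrow> ('f, 'r, 'a) imag set \<Rightarrow> bool"
    and M P :: "'a set"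
    and I :: "'i set" and c :: "'i \<Rightarrow> ('f, 'r, 'a) imag"
    and J :: "'j set" and a :: "'j \<Rightarrow> ('f, 'r, 'a) imag"
  assumes "complete_theory L T"
    and "monster_model L T \<CC> mon"
    and "independence_relation L \<CC> mon ind"
    and "is_kappa0 \<CC> mon ind \<kappa>0"
    and "Card_order \<kappa>" and "\<kappa> <o mon" and "\<kappa>0 <o \<kappa>" and "|T| <o \<kappa>"
    and "independence_relation (eq_lang L \<CC>) (eq_struct L \<CC>) mon ind_eq"
    and "extends_to_eq \<CC> mon ind ind_eq"
    and "pair_model L \<CC> M P" and "|M| <o mon"
    and "closed_in \<CC> ind M P"
    and "density_property L \<CC> ind \<kappa> M P"
    and "|I| <o \<kappa>" and "c ` I \<subseteq> imaginaries L \<CC> M"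
    and "|J| <o \<kappa>" and "a ` J \<subseteq> imaginaries L \<CC> M"
    and "ind_eq (c ` I) (P_eq L \<CC> ind_eq P (a ` J)) (a ` J)"
  shows "\<exists>c'. c' ` I \<subseteq> imaginaries L \<CC> M \<and>
           c' ` I \<subseteq> cl (eq_struct L \<CC>) ind_eq (Elem ` P) \<and>
           same_type (eq_lang L \<CC>) (eq_struct L \<CC>) (a ` J) I c c'"
proof -
  have S: "is_struct L \<CC>" and mon: "Card_order mon" "infinite (Field mon)"
    and hom: "strongly_homogeneous L \<CC> mon"
    using assms(2) by (auto simp: monster_model_def)
  interpret imaginary_independence L \<CC> mon ind ind_eq
    using assms(3,9,10) S mon hom
    by (intro imaginary_independence.intro monster_independence.intro
        monster_independence_axioms.intro imaginary_independence_axioms.intro)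
  have bound: "local_bound \<CC> mon ind \<kappa>0" using assms(4) by (simp add: is_kappa0_def)
  then have \<kappa>0: "Card_order \<kappa>0" "infinite (Field \<kappa>0)" by (auto simp: local_bound_def)
  note \<kappa> = \<open>Card_order \<kappa>\<close> \<open>\<kappa> <o mon\<close> and \<kappa>0\<kappa> = \<open>\<kappa>0 <o \<kappa>\<close>
  have inf\<kappa>: "infinite (Field \<kappa>)"
    using cinfinite_mono[OF ordLess_imp_ordLeq[OF \<kappa>0\<kappa>]] \<kappa>0(2) by (simp add: cinfinite_def)
  have M: "M \<subseteq> univ \<CC>" "P \<subseteq> M"
    using assms(11) by (auto simp: pair_model_def elem_substruct_def)
  have smM: "real.small M" using M(1) assms(12) by (simp add: small_in_def)
  have smP: "real.small P" by (rule real.small_subset[OF smM M(2)])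
  note imagM = imaginaries_mono[OF M(1), of L \<CC>]
  define U where "U = a ` J"
  define Q where "Q = P_eq L \<CC> ind_eq P U"
  have U\<kappa>: "|U| <o \<kappa>" unfolding U_def by (rule ordLeq_ordLess_trans[OF card_of_image assms(17)])
  have smU: "imag.small U"
    using assms(18) imagM ordLess_transitive[OF U\<kappa> \<kappa>(2)] by (auto simp: small_in_def U_def)
  have Q: "Q \<subseteq> U" "Q \<subseteq> cl (eq_struct L \<CC>) ind_eq (Elem ` P)" by (auto simp: Q_def P_eq_def)
  have Q\<kappa>: "|Q| <o \<kappa>" by (rule ordLeq_ordLess_trans[OF card_of_mono1[OF Q(1)] U\<kappa>])
  have smQ: "imag.small Q" by (rule imag.small_subset[OF smU Q(1)])
  have c: "c ` I \<subseteq> imaginaries L \<CC> (univ \<CC>)" using assms(16) imagM by blast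
  obtain D k xs where D: "D \<subseteq> univ \<CC>" "|D| <o \<kappa>" "ind_eq (Elem ` D) Q U"
    and k: "\<And>i. i \<in> I \<Longrightarrow> is_sort L \<CC> (k i)" and xs: "\<And>i. i \<in> I \<Longrightarrow> xs i \<in> tuples D (sort_arity (k i))"
    and cx: "\<And>i. i \<in> I \<Longrightarrow> c i = imag_of \<CC> (k i) (xs i)"
    by (rule independent_representatives[OF \<kappa> \<kappa>0 \<kappa>0\<kappa> assms(15) c smQ smU assms(19)[folded U_def, folded Q_def]])
      blast
  have smD: "real.small D" by (rule real_small[OF D(1,2) \<kappa>(2)])
  \<comment> \<open>A real set \<open>A\<close> over which \<open>a\<close> is definable and whose part in \<open>P\<close> has \<open>Q\<close> in its closure.\<close>
  obtain k' ys where k': "\<And>j. j \<in> J \<Longrightarrow> is_sort L \<CC> (k' j)"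
    and ys: "\<And>j. j \<in> J \<Longrightarrow> ys j \<in> tuples (\<Union>j\<in>J. set (ys j)) (sort_arity (k' j))"
    and ay: "\<And>j. j \<in> J \<Longrightarrow> a j = imag_of \<CC> (k' j) (ys j)" and A0M: "(\<Union>j\<in>J. set (ys j)) \<subseteq> M"
    using imaginaries_representatives[OF assms(18)] by blast
  obtain P0 where P0: "P0 \<subseteq> P" "|P0| <o \<kappa>" "Q \<subseteq> cl (eq_struct L \<CC>) ind_eq (Elem ` P0)"
    by (rule small_closure_base[OF \<kappa> bound \<kappa>0\<kappa> Q\<kappa> Q(2) smP])
  define A where "A = (\<Union>j\<in>J. set (ys j)) \<union> P0"
  have "|\<Union>j\<in>J. set (ys j)| <o \<kappa>"
    by (rule card_of_UNION_ordLess[OF \<kappa>(1) \<kappa>0 \<kappa>0\<kappa> assms(17)]) (rule finite_ordLeq_infinite[OF \<kappa>0], simp)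
  then have A\<kappa>: "|A| <o \<kappa>"
    unfolding A_def by (rule card_of_Un_ordLess_infinite_Field[OF inf\<kappa> \<kappa>(1) _ P0(2)])
  have AM: "A \<subseteq> M" using A0M P0(1) M(2) by (auto simp: A_def)
  have smA: "real.small A" by (rule real.small_subset[OF smM AM])
  have ysA: "ys j \<in> tuples A (sort_arity (k' j))" if "j \<in> J" for j
    using ys[OF that] tuples_mono[of "\<Union>j\<in>J. set (ys j)" A] by (auto simp: A_def)
  have rep: "\<exists>k xs. is_sort L \<CC> k \<and> xs \<in> tuples A (sort_arity k) \<and> u = imag_of \<CC> k xs" if "u \<in> U" for u
    using that k' ysA ay by (auto simp: U_def)
  obtain \<sigma> where \<sigma>: "\<sigma> \<in> automorphisms L \<CC>" "\<And>u. u \<in> U \<Longrightarrow> imag_map \<sigma> u = u"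
    and ind: "ind_eq (Elem ` \<sigma> ` D) Q (Elem ` A)"
    using independent_conjugate[OF smA smD smU Q(1) rep D(3)] by blast
  have \<sigma>D: "\<sigma> ` D \<subseteq> univ \<CC>" using D(1) automorphism_univ[OF \<sigma>(1)] by blast
  have \<sigma>D\<kappa>: "|\<sigma> ` D| <o \<kappa>" by (rule ordLeq_ordLess_trans[OF card_of_image D(2)])
  have sm\<sigma>D: "real.small (\<sigma> ` D)" by (rule real_small[OF \<sigma>D \<sigma>D\<kappa> \<kappa>(2)])
  have smPA: "real.small (P \<inter> A)" by (rule real.small_subset[OF smA]) simp
  have "Q \<subseteq> cl (eq_struct L \<CC>) ind_eq (Elem ` (P \<inter> A))"
  proof (rule order_trans[OF P0(3) imag.cl_mono[OF image_mono small_Elem[OF smPA]]])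
    show "P0 \<subseteq> P \<inter> A" using P0(1) by (auto simp: A_def)
  qed
  from imag.ind_change_base[OF small_Elem[OF sm\<sigma>D] small_Elem[OF smA] smQ ind _ this]
  have "ind_eq (Elem ` \<sigma> ` D) (Elem ` (P \<inter> A)) (Elem ` A)" by blast
  then have "ind (\<sigma> ` D) (P \<inter> A) A"
    using extends sm\<sigma>D smPA smA by (simp add: extends_to_eq_def)
  then obtain \<tau> where \<tau>: "\<tau> \<in> automorphisms L \<CC>" "\<And>x. x \<in> A \<Longrightarrow> \<tau> x = x" "\<tau> ` \<sigma> ` D \<subseteq> P"
    using real.density_real_tuple[OF S hom assms(14) M \<kappa>(1) inf\<kappa> \<kappa>(2) AM A\<kappa> \<sigma>D \<sigma>D\<kappa>] by blast
  have \<tau>U: "imag_map \<tau> u = u" if u: "u \<in> U" for u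
  proof -
    obtain k xs where *: "is_sort L \<CC> k" "xs \<in> tuples A (sort_arity k)" "u = imag_of \<CC> k xs"
      using rep[OF u] by blast
    have "map \<tau> xs = xs" by (rule map_idI) (use *(2) \<tau>(2) in \<open>auto simp: tuples_def\<close>)
    moreover have "xs \<in> tuples (univ \<CC>) (sort_arity k)"
      using *(2) AM M(1) by (auto simp: tuples_def)
    ultimately show ?thesis using imag_map_imag_of[OF S \<tau>(1) *(1)] *(3) by metis
  qed
  define c' where "c' i = imag_map \<tau> (imag_map \<sigma> (c i))" for i
  have c': "c' i = imag_of \<CC> (k i) (map \<tau> (map \<sigma> (xs i)))"
    and tP: "map \<tau> (map \<sigma> (xs i)) \<in> tuples P (sort_arity (k i))" if i: "i \<in> I" for i
  proof -
    have 1: "xs i \<in> tuples (univ \<CC>) (sort_arity (k i))" using xs[OF i] tuples_mono[OF D(1)] by blast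
    show "c' i = imag_of \<CC> (k i) (map \<tau> (map \<sigma> (xs i)))"
      unfolding c'_def cx[OF i] imag_map_imag_of[OF S \<sigma>(1) k[OF i] 1]
      by (rule imag_map_imag_of[OF S \<tau>(1) k[OF i] map_automorphism_tuples[OF \<sigma>(1) 1]])
    show "map \<tau> (map \<sigma> (xs i)) \<in> tuples P (sort_arity (k i))"
      using xs[OF i] \<tau>(3) by (auto simp: tuples_def)
  qed
  have "c' i \<in> imaginaries L \<CC> M" if i: "i \<in> I" for i
    unfolding imaginaries_iff using c'[OF i] tP[OF i] k[OF i] tuples_mono[OF M(2)] by blast
  moreover have "c' i \<in> cl (eq_struct L \<CC>) ind_eq (Elem ` P)" if i: "i \<in> I" for i
    unfolding c'[OF i] by (rule imag_of_in_cl[OF k[OF i] tP[OF i] smP])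
  moreover have "same_type (eq_lang L \<CC>) (eq_struct L \<CC>) U I c c'"
  proof -
    note eq = eq_struct_is_struct[OF S] and \<sigma>eq = imag_map_automorphism[OF S \<sigma>(1)]
      and \<tau>eq = imag_map_automorphism[OF S \<tau>(1)]
    have Uu: "U \<subseteq> univ (eq_struct L \<CC>)" using smU by (simp add: small_in_def)
    have cu: "c ` I \<subseteq> univ (eq_struct L \<CC>)" using c by simp
    have \<sigma>c: "(imag_map \<sigma> \<circ> c) ` I \<subseteq> univ (eq_struct L \<CC>)"
      using cu automorphism_univ[OF \<sigma>eq] by auto
    have c'_eq: "c' = imag_map \<tau> \<circ> (imag_map \<sigma> \<circ> c)" by (simp add: fun_eq_iff c'_def)
    have "same_type (eq_lang L \<CC>) (eq_struct L \<CC>) U I (imag_map \<sigma> \<circ> c) c'"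
      unfolding c'_eq by (rule same_type_automorphism[OF eq \<tau>eq Uu \<tau>U \<sigma>c])
    with same_type_automorphism[OF eq \<sigma>eq Uu \<sigma>(2) cu] show ?thesis
      by (rule same_type_trans)
  qed
  ultimately show ?thesis unfolding U_def by blast
qed

end
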